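(* Let $P_n \square P_n$ denote the Cartesian product of two paths on $n$ vertices each (the $n\times n$ square grid), and let $\rho(P_n\square P_n)$ be its surviving rate in the firefighter problem. Then, as $n\to\infty$, $$0.625 + o(1) = \frac{5}{8} + o(1) \le \rho(P_n \square P_n) \le \frac{67243}{105300} + o(1) < 0.6386,$$ where the last inequality holds for all sufficiently large $n$.
   Context: Firefighter problem on a finite graph $G=(V,E)$: a fire breaks out at a vertex $v\in V$ (at time $0$). In each subsequent turn $1,2,3,\dots$, the firefighter first protects one vertex which is not yet on fire, and then the fire spreads to all unprotected neighbors of the vertices already on fire. Once a vertex is on fire or is protected it stays in that state forever. The game stops when no neighbor of a burning vertex is unprotected and not burning (the fire cannot spread). A vertex is saved if it never catches fire (protected vertices count as saved). $\mathrm{sn}(G,v)$ is the number of vertices of $G$ the firefighter can save when the fire breaks out at $v$, assuming the best strategy is used. The surviving rate of a finite graph $G$ with vertex set $V$ is $$\rho(G)=\frac{1}{|V|^2}\sum_{v\in V}\mathrm{sn}(G,v),$$ i.e. the expected proportion of saved vertices when the fire breaks out at a uniformly random vertex. $o(1)$ denotes a quantity tending to $0$ as $n\to\infty$. *)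

theory Defs
  imports Complex_Main "HOL-Library.Landau_Symbols" "Graph_Theory.Pair_Digraph"
begin

section \<open>Paths and Cartesian products of graphs\<close>

definition path_graph :: "nat \<Rightarrow> nat pair_pre_digraph" where
  "path_graph n =
     \<lparr> pverts = {..<n},
       parcs = {(i, j). i < n \<and> j < n \<and> (j = Suc i \<or> i = Suc j)} \<rparr>"

definition box_product ::
  "'a pair_pre_digraph \<Rightarrow> 'b pair_pre_digraph \<Rightarrow> ('a \<times> 'b) pair_pre_digraph"
  (infixr "\<box>" 80) where
  "G \<box> H =
     \<lparr> pverts = pverts G \<times> pverts H,
       parcs = {((a, b), (a', b')).
         (a = a' \<and> a \<in> pverts G \<and> (b, b') \<in> parcs H) \<or>
         ((a, a') \<in> parcs G \<and> b = b' \<and> b \<in> pverts H)} \<rparr>"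

lemma pair_graph_path_graph: "pair_graph (path_graph n)"
proof -
  have "finite (parcs (path_graph n))"
    by (rule finite_subset[of _ "{..<n} \<times> {..<n}"]) (auto simp: path_graph_def)
  then show ?thesis
    by unfold_locales (auto simp: path_graph_def symmetric_def intro!: symI)
qed

lemma pair_graph_box_product:
  assumes "pair_graph G" "pair_graph H"
  shows "pair_graph (G \<box> H)"
proof -
  interpret G: pair_graph G by fact
  interpret H: pair_graph H by fact
  have sub: "parcs (G \<box> H) \<subseteq> (pverts G \<times> pverts H) \<times> (pverts G \<times> pverts H)"
    using G.wellformed' H.wellformed' by (auto simp: box_product_def)
  have verts: "pverts (G \<box> H) = pverts G \<times> pverts H"
    by (simp add: box_product_def)
  have fin: "finite (pverts G \<times> pverts H)"
    using G.pair_finite_verts H.pair_finite_verts by simp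
  have symG: "(y, x) \<in> parcs G" if "(x, y) \<in> parcs G" for x y
    using G.pair_sym_arcs that by (simp add: symmetric_def sym_def)
  have symH: "(y, x) \<in> parcs H" if "(x, y) \<in> parcs H" for x y
    using H.pair_sym_arcs that by (simp add: symmetric_def sym_def)
  show ?thesis
  proof unfold_locales
    show "finite (parcs (G \<box> H))" using finite_subset[OF sub] fin by blast
    show "finite (pverts (G \<box> H))" using fin by (simp add: box_product_def)
    show "symmetric (with_proj (G \<box> H))"
      by (auto simp: box_product_def symmetric_def intro!: symI intro: symG symH)
  next
    fix e assume e: "e \<in> parcs (G \<box> H)"
    then show "fst e \<in> pverts (G \<box> H)" "snd e \<in> pverts (G \<box> H)"
      using subsetD[OF sub e] by (auto simp: verts)
    obtain a b a' b' where e_eq: "e = ((a, b), (a', b'))" by (metis prod.exhaust)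
    from e have "(b, b') \<in> parcs H \<or> (a, a') \<in> parcs G"
      by (auto simp: e_eq box_product_def)
    then show "fst e \<noteq> snd e"
      using G.pair_no_loops[of "(a, a')"] H.pair_no_loops[of "(b, b')"] by (auto simp: e_eq)
  qed
qed


section \<open>The firefighter game\<close>

text \<open>
  A position is given by the set \<open>B\<close> of burning vertices and the set \<open>D\<close> of protected vertices.
\<close>

definition threatened :: "'a pair_pre_digraph \<Rightarrow> 'a set \<Rightarrow> 'a set \<Rightarrow> 'a set" where
  "threatened G B D = {w \<in> pverts G. w \<notin> B \<and> w \<notin> D \<and> (\<exists>u\<in>B. (u, w) \<in> parcs G)}"

inductive reachable_position ::
  "'a pair_pre_digraph \<Rightarrow> 'a \<Rightarrow> 'a set \<Rightarrow> 'a set \<Rightarrow> bool"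
  for G :: "'a pair_pre_digraph" and v :: 'a where
  outbreak: "reachable_position G v {v} {}"
| turn:
    "\<lbrakk> reachable_position G v B D; threatened G B D \<noteq> {}; x \<in> pverts G - B \<rbrakk>
     \<Longrightarrow> reachable_position G v (B \<union> threatened G B (insert x D)) (insert x D)"

text \<open>
  Since the game has no adversary, a strategy is the same as a play. In a final position the
  burning vertices are exactly those that ever caught fire.
\<close>

definition final_position ::
  "'a pair_pre_digraph \<Rightarrow> 'a \<Rightarrow> 'a set \<Rightarrow> 'a set \<Rightarrow> bool" where
  "final_position G v B D \<longleftrightarrow> reachable_position G v B D \<and> threatened G B D = {}"

definition sn :: "'a pair_pre_digraph \<Rightarrow> 'a \<Rightarrow> nat" where
  "sn G v = Max {card (pverts G - B) | B D. final_position G v B D}"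

definition surviving_rate :: "'a pair_pre_digraph \<Rightarrow> real" where
  "surviving_rate G = (\<Sum>v\<in>pverts G. real (sn G v)) / (real (card (pverts G)))\<^sup>2"

text \<open>
  The maximum defining \<open>sn\<close> is taken over a finite nonempty set: every play on a finite graph
  can be continued to a final position.
\<close>

lemma ex_final_position:
  assumes "finite (pverts G)"
  shows "\<exists>B D. final_position G v B D"
proof -
  have "\<exists>B' D'. final_position G v B' D'" if "reachable_position G v B D" for B D
    using that
  proof (induction "card (pverts G - B) + card (pverts G - D)"
      arbitrary: B D rule: less_induct)
    case less
    show ?case
    proof (cases "threatened G B D = {}")
      case True
      with less.prems have "final_position G v B D" by (simp add: final_position_def)
      then show ?thesis by blast
    next
      case False
      then obtain x where x: "x \<in> pverts G" "x \<notin> B" "x \<notin> D"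
        by (auto simp: threatened_def)
      let ?B = "B \<union> threatened G B (insert x D)" and ?D = "insert x D"
      have "x \<in> pverts G - B" using x by simp
      then have r: "reachable_position G v ?B ?D"
        by (rule turn[OF less.prems False])
      have "card (pverts G - ?B) \<le> card (pverts G - B)"
        by (rule card_mono) (use assms in auto)
      moreover have "card (pverts G - ?D) < card (pverts G - D)"
        by (rule psubset_card_mono) (use assms x in auto)
      ultimately have "card (pverts G - ?B) + card (pverts G - ?D)
          < card (pverts G - B) + card (pverts G - D)"
        by (rule add_le_less_mono)
      then show ?thesis using r by (rule less.hyps)
    qed
  qed
  from this[OF outbreak] show ?thesis .
qed

lemma sn_attained:
  assumes "finite (pverts G)"
  shows "\<exists>B D. final_position G v B D \<and> sn G v = card (pverts G - B)"
    and "final_position G v B D \<Longrightarrow> card (pverts G - B) \<le> sn G v"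
proof -
  let ?S = "{card (pverts G - B) | B D. final_position G v B D}"
  have "?S \<subseteq> {..card (pverts G)}"
    using card_mono[OF assms Diff_subset] by auto
  then have fin: "finite ?S" by (rule finite_subset) simp
  have "?S \<noteq> {}" using ex_final_position[OF assms] by blast
  from Max_in[OF fin this] have "sn G v \<in> ?S" by (simp only: sn_def)
  then show "\<exists>B D. final_position G v B D \<and> sn G v = card (pverts G - B)" by blast
  show "card (pverts G - B) \<le> sn G v" if "final_position G v B D"
  proof -
    have "card (pverts G - B) \<in> ?S" using that by blast
    then show ?thesis unfolding sn_def by (rule Max_ge[OF fin])
  qed
qed

end

theory Submission
  imports Defs
begin

text \<open>
  Write \<open>N = n - 1\<close>, let the fire break out at \<open>v = (i, j)\<close>, and let \<open>b\<close> be the distance from \<open>v\<close> to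
  the nearest side of the grid.

  The upper bound follows the fire along shortest paths only: a vertex at distance \<open>t\<close> from \<open>v\<close>
  counts as burnt if it burns at time \<open>t\<close>. The vertices at distance \<open>t\<close> split into four
  quadrants, the rotations of \<open>{x > 0, y \<ge> 0}\<close>; let \<open>u\<^sub>k(t)\<close> count the unburnt ones in the \<open>k\<close>-th.
  Away from the sides a burning part of a level has at least one more neighbour on the next level,
  so an unburnt part grows only through vertices protected in time, and there are at most \<open>t\<close> of
  those: \<open>\<Sum>\<^sub>k u\<^sub>k(t) \<le> t\<close> (\<open>unburnt_le_timely\<close>). Once a quadrant is past both of its walls, an
  unburnt part loses a vertex per step (\<open>new_unburnt_past_walls\<close>). Let \<open>M = N - b\<close> be the largest
  distance to a side and \<open>A(s)\<close> the number of quadrants that have an unburnt vertex at level \<open>s\<close>.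
  Then for \<open>t > M\<close>

    \<open>\<Sum>\<^sub>k u\<^sub>k(t) \<le> t - \<Sum>\<^bsub>M<s<t\<^esub> A(s)\<close>,

  while \<open>\<Sum>\<^sub>k u\<^sub>k(t)\<close> is also at most the total size of level \<open>t\<close> in the quadrants counted by \<open>A(t)\<close>.
  The firefighter can stockpile protected vertices and thereby keep \<open>A\<close> small at first, which
  weakens the first inequality but strengthens the second. In the average of the two, summed over
  \<open>M < t \<le> n\<close>, what is left of each occurrence of a quadrant in \<open>A\<close> is a constant that does not
  depend on \<open>t\<close> (\<open>sum_unburnt_between\<close>). For \<open>t > n\<close> the size of the level is bound enough.
  Altogether

    \<open>4 sn(v) \<le> 2n\<^sup>2 + 2n - 3b\<^sup>2 + 2((N-i-j)\<^sup>2 + (i-j)\<^sup>2)\<close>   (\<open>sn_grid_upper\<close>),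

  whose average over \<open>v\<close> is \<open>4n\<^sup>2 \<cdot> 61/96 + O(n)\<close>, and \<open>61/96 = 0.6354... < 67243/105300\<close>.

  For the lower bound, a barrier shaped like a V with apex just above \<open>v\<close> and arms of slope one is
  built alternately to the left and to the right; when the left arm has reached its side, the right
  arm goes on horizontally. Each barrier vertex is protected by the time when the fire could first reach it
  (\<open>barrier_in_time\<close>). If \<open>v\<close> is at distance \<open>b\<close> from the bottom and \<open>a \<ge> b\<close> from the
  left side, this saves \<open>n\<^sup>2 - n(a + b) + a\<^sup>2 - O(n)\<close> vertices. The symmetries of the square reduce
  every \<open>v\<close> to this position, and the average over \<open>v\<close> is \<open>5n\<^sup>2/8 - O(n)\<close>.
\<close>

section \<open>Fire along shortest paths\<close>

text \<open>
  For a position reached at time \<open>T\<close>, with \<open>dst\<close> in the role of the distance from \<open>v\<close>, \<open>F\<close> is a set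
  of vertices \<open>w\<close> that burn by time \<open>dst w\<close>, and \<open>E\<close> contains the vertices \<open>w\<close> protected no later
  than time \<open>dst w\<close>. A vertex protected later than that cannot stop the fire from reaching it along a
  shortest path.
\<close>

definition fast_record ::
  "'a pair_pre_digraph \<Rightarrow> ('a \<Rightarrow> nat) \<Rightarrow> 'a \<Rightarrow> 'a set \<Rightarrow> 'a set \<Rightarrow> nat \<Rightarrow> 'a set \<Rightarrow> 'a set \<Rightarrow> bool" where
  "fast_record G dst v B D T F E \<longleftrightarrow>
     v \<in> F \<and> F \<subseteq> B \<and> (\<forall>u\<in>F. dst u \<le> T) \<and>
     E \<subseteq> D \<and> (\<forall>u\<in>E. dst u \<le> T) \<and> finite D \<and> card D \<le> T \<and>
     (\<forall>u\<in>F. \<forall>w\<in>pverts G. dst u < T \<longrightarrow> (u, w) \<in> parcs G \<longrightarrow> dst w = Suc (dst u) \<longrightarrow>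
        w \<notin> E \<longrightarrow> w \<in> F) \<and>
     (\<forall>t. card {w \<in> E. dst w \<le> t} \<le> t)"

text \<open>
  At most \<open>t\<close> vertices are protected up to time \<open>t\<close>. Vertices with \<open>dst w > T\<close> affect the count only
  for \<open>t > T\<close>, and there the total number of protected vertices is small enough.
\<close>

lemma card_timely_extend:
  assumes "\<And>t. card {w \<in> E. dst w \<le> t} \<le> (t::nat)" "E \<subseteq> D" "finite D" "card D \<le> Suc T"
  shows "card {w \<in> E \<union> {w \<in> D. dst w > T}. dst w \<le> t} \<le> t"
proof (cases "t \<le> T")
  case True
  then have "{w \<in> E \<union> {w \<in> D. dst w > T}. dst w \<le> t} = {w \<in> E. dst w \<le> t}" by auto
  then show ?thesis using assms(1) by simp
next
  case False
  have "card {w \<in> E \<union> {w \<in> D. dst w > T}. dst w \<le> t} \<le> card D"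
    by (rule card_mono) (use assms in auto)
  then show ?thesis using assms(4) False by simp
qed

lemma fast_record_turn:
  fixes x
  assumes "fast_record G dst v B D T F E"
  defines "D' \<equiv> insert x D" and "B' \<equiv> B \<union> threatened G B (insert x D)"
  shows "fast_record G dst v B' D' (Suc T) (F \<union> {w \<in> B'. dst w = Suc T}) (E \<union> {w \<in> D'. dst w = Suc T})"
proof -
  let ?F = "F \<union> {w \<in> B'. dst w = Suc T}" and ?E = "E \<union> {w \<in> D'. dst w = Suc T}"
  have I: "v \<in> F" "F \<subseteq> B" "\<forall>u\<in>F. dst u \<le> T" "E \<subseteq> D"
      "\<forall>u\<in>E. dst u \<le> T" "finite D" "card D \<le> T"
      "\<forall>u\<in>F. \<forall>w\<in>pverts G. dst u < T \<longrightarrow> (u, w) \<in> parcs G \<longrightarrow> dst w = Suc (dst u) \<longrightarrow> w \<notin> E \<longrightarrow> w \<in> F"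
      "\<And>t. card {w \<in> E. dst w \<le> t} \<le> t"
    using assms(1) by (auto simp: fast_record_def)
  have D': "finite D'" "card D' \<le> Suc T" "D \<subseteq> D'"
    using I(6,7) by (auto simp: D'_def card_insert_if)
  have "card {w \<in> ?E. dst w \<le> t} \<le> t" for t
  proof -
    have "card {w \<in> ?E. dst w \<le> t} \<le> card {w \<in> E \<union> {w \<in> D'. dst w > T}. dst w \<le> t}"
      using D' I(4) by (intro card_mono finite_subset[OF _ D'(1)]) auto
    also have "\<dots> \<le> t"
      by (rule card_timely_extend) (use I(4) D' I(9) in auto)
    finally show ?thesis .
  qed
  moreover have "w \<in> ?F" if w: "u \<in> ?F" "w \<in> pverts G" "dst u < Suc T" "(u, w) \<in> parcs G"
    "dst w = Suc (dst u)" "w \<notin> ?E" for u w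
  proof -
    have u: "u \<in> F" using w by auto
    show ?thesis
    proof (cases "dst u < T")
      case True
      then show ?thesis using I(8) u w by blast
    next
      case False
      then have "dst w = Suc T" using w by simp
      moreover have "u \<in> B" using u I(2) by blast
      ultimately have "w \<notin> D'" using w by blast
      then have "w \<in> B'" using \<open>u \<in> B\<close> w by (auto simp: threatened_def B'_def D'_def)
      then show ?thesis using \<open>dst w = Suc T\<close> by blast
    qed
  qed
  moreover have "\<forall>u\<in>?F. dst u \<le> Suc T" "\<forall>u\<in>?E. dst u \<le> Suc T" using I(3,5) by (auto simp: le_Suc_eq)
  moreover have "?E \<subseteq> D'" "v \<in> ?F" "?F \<subseteq> B'" using I(1,2,4) D' by (auto simp: B'_def)
  ultimately show ?thesis unfolding fast_record_def using D' by blast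
qed

lemma reachable_fast_record:
  assumes "reachable_position G v B D" "dst v = (0::nat)"
  shows "\<exists>T F E. fast_record G dst v B D T F E"
  using assms
proof (induction rule: reachable_position.induct)
  case outbreak
  then have "fast_record G dst v {v} {} 0 {v} {}" by (simp add: fast_record_def)
  then show ?case by blast
next
  case (turn B D x)
  then obtain T F E where "fast_record G dst v B D T F E" by blast
  from fast_record_turn[OF this] show ?case by blast
qed

text \<open>
  A finished game, read as a spreading process that forgets about time: the fire passes from level
  to level unless a vertex of \<open>E\<close> stops it, and \<open>E\<close> obeys the firefighter's budget on every ball.
\<close>

lemma fast_fire:
  assumes "final_position G v B D" and "dst v = (0::nat)"
  obtains F E where "v \<in> F" "F \<subseteq> B"
    "\<And>u w. u \<in> F \<Longrightarrow> w \<in> pverts G \<Longrightarrow> (u, w) \<in> parcs G \<Longrightarrow> dst w = Suc (dst u) \<Longrightarrow> w \<notin> E \<Longrightarrow> w \<in> F"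
    "\<And>t. card {w \<in> E. dst w \<le> t} \<le> t" "finite E"
proof -
  have fin: "threatened G B D = {}" and r: "reachable_position G v B D"
    using assms(1) by (auto simp: final_position_def)
  obtain T F E where "fast_record G dst v B D T F E"
    using reachable_fast_record[where dst = dst, OF r assms(2)] by blast
  then have I: "v \<in> F" "F \<subseteq> B" "\<forall>u\<in>F. dst u \<le> T" "E \<subseteq> D"
      "\<forall>u\<in>E. dst u \<le> T" "finite D" "card D \<le> T"
      "\<forall>u\<in>F. \<forall>w\<in>pverts G. dst u < T \<longrightarrow> (u, w) \<in> parcs G \<longrightarrow> dst w = Suc (dst u) \<longrightarrow> w \<notin> E \<longrightarrow> w \<in> F"
      "\<And>t. card {w \<in> E. dst w \<le> t} \<le> t"
    by (auto simp: fast_record_def)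
  \<comment> \<open>After time \<open>T\<close> nothing changes, so the final \<open>B\<close> and \<open>D\<close> describe all later levels.\<close>
  let ?F = "F \<union> {w \<in> B. dst w > T}" and ?E = "E \<union> {w \<in> D. dst w > T}"
  show ?thesis
  proof (rule that)
    show "v \<in> ?F" "?F \<subseteq> B" using I(1,2) by auto
    show "finite ?E" using I(4,6) by (auto intro: finite_subset)
    show "card {w \<in> ?E. dst w \<le> t} \<le> t" for t
      by (rule card_timely_extend) (use I(4,6,7,9) in auto)
    show "w \<in> ?F" if w: "u \<in> ?F" "w \<in> pverts G" "(u, w) \<in> parcs G"
        "dst w = Suc (dst u)" "w \<notin> ?E" for u w
    proof (cases "dst u < T")
      case True
      then have "u \<in> F" using w by auto
      then show ?thesis using I(8) True w by blast
    next
      case False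
      then have "dst w > T" using w(4) by simp
      moreover have "u \<in> B" using w(1) I(2) by blast
      moreover have "w \<notin> D" using w(5) \<open>dst w > T\<close> by blast
      ultimately show ?thesis using w fin unfolding threatened_def by blast
    qed
  qed
qed

section \<open>Unburnt vertices in the four quadrants\<close>

text \<open>
  Quadrant \<open>k\<close> has local coordinates \<open>(x, y)\<close> with \<open>1 \<le> x \<le> d k\<close> and \<open>0 \<le> y \<le> d (k + 1)\<close>, indices
  modulo 4. A vertex of level \<open>t\<close> is represented by \<open>x\<close> alone, as \<open>y = t - x\<close>. The unburnt vertices
  of level \<open>t\<close> are \<open>U k t\<close>, and \<open>E k t\<close> are those protected in time. An unburnt vertex that was not
  protected has unburnt predecessors \<open>(x, y - 1)\<close> (\<open>U_same\<close>) and \<open>(x - 1, y)\<close> (\<open>U_shift\<close>). The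
  quadrant does not contain its axis \<open>x = 0\<close>: the point \<open>(0, t)\<close> has coordinates \<open>(t, 0)\<close> in
  quadrant \<open>k + 1\<close>, whence \<open>U_axis\<close>.
\<close>

locale four_fronts =
  fixes d :: "nat \<Rightarrow> nat" and U E :: "nat \<Rightarrow> nat \<Rightarrow> nat set"
  assumes U_range: "k < 4 \<Longrightarrow> x \<in> U k t \<Longrightarrow> 1 \<le> x \<and> x \<le> t \<and> x \<le> d k \<and> t \<le> x + d (Suc k mod 4)"
    and U_start: "k < 4 \<Longrightarrow> U k 1 \<subseteq> E k 1"
    and U_same: "k < 4 \<Longrightarrow> 1 \<le> t \<Longrightarrow> x \<in> U k (Suc t) \<Longrightarrow> x \<notin> E k (Suc t) \<Longrightarrow> x \<le> t \<Longrightarrow> x \<in> U k t"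
    and U_shift: "k < 4 \<Longrightarrow> 1 \<le> t \<Longrightarrow> x \<in> U k (Suc t) \<Longrightarrow> x \<notin> E k (Suc t) \<Longrightarrow> 2 \<le> x \<Longrightarrow> x - 1 \<in> U k t"
    and U_axis: "k < 4 \<Longrightarrow> 1 \<le> t \<Longrightarrow> 1 \<in> U k (Suc t) \<Longrightarrow> 1 \<notin> E k (Suc t) \<Longrightarrow> t \<in> U (Suc k mod 4) t"
    and E_fin: "finite (E k t)"
    and budget: "(\<Sum>s=1..t. \<Sum>k<4. card (E k s)) \<le> t"
begin

lemma U_fin: "k < 4 \<Longrightarrow> finite (U k t)"
  by (rule finite_subset[of _ "{..t}"]) (auto dest: U_range)

definition unburnt :: "nat \<Rightarrow> nat" where "unburnt t = (\<Sum>k<4. card (U k t))"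

definition timely :: "nat \<Rightarrow> nat" where "timely t = (\<Sum>s=1..t. \<Sum>k<4. card (E k s))"

lemma card_U_Suc_le:
  assumes "k < 4" "card (U k (Suc t) - E k (Suc t)) \<le> m"
  shows "card (U k (Suc t)) \<le> m + card (E k (Suc t))"
proof -
  have "card (U k (Suc t)) \<le> card ((U k (Suc t) - E k (Suc t)) \<union> E k (Suc t))"
    by (rule card_mono) (auto simp: U_fin E_fin assms)
  also have "\<dots> \<le> card (U k (Suc t) - E k (Suc t)) + card (E k (Suc t))"
    by (rule card_Un_le)
  finally show ?thesis using assms by simp
qed

text \<open>
  A burnt vertex \<open>a\<close> separates the unburnt part of level \<open>t + 1\<close> into the points left of \<open>a\<close>, which keep
  their coordinate \<open>x\<close> when traced back to level \<open>t\<close>, and those right of \<open>a\<close>, which move from \<open>x\<close> to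
  \<open>x - 1\<close>; this is injective. Past a wall, one of the two movements works for all points at once. The
  remaining case is a quadrant that is entirely unburnt before its walls are reached. Its \<open>t\<close> vertices
  exhaust the assumed bound, hence level \<open>t\<close> burns completely in the next quadrant, and the fire enters from
  there over the common axis.
\<close>

lemma new_unburnt_le:
  assumes k: "k < 4" and t: "1 \<le> t" and le: "unburnt t \<le> t"
  shows "card (U k (Suc t) - E k (Suc t)) \<le> card (U k t)"
proof -
  let ?V = "U k (Suc t) - E k (Suc t)"
  have fin: "finite (U k t)" using U_fin k by blast
  consider (short) "d k \<le> t" | (low) "d (Suc k mod 4) < t"
    | (gap) a where "1 \<le> a" "a \<le> t" "a \<notin> U k t"
    | (full) "t \<le> d (Suc k mod 4)" "{1..t} \<subseteq> U k t"
    by (metis atLeastAtMost_iff not_le subsetI)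
  then show ?thesis
  proof cases
    case short
    have "?V \<subseteq> U k t"
    proof
      fix x assume "x \<in> ?V"
      then show "x \<in> U k t" using U_same[OF k t] U_range[OF k, of x "Suc t"] short by auto
    qed
    then show ?thesis by (rule card_mono[OF fin])
  next
    case low
    have *: "2 \<le> x" if "x \<in> ?V" for x using U_range[OF k, of x "Suc t"] low that by auto
    show ?thesis
    proof (rule card_inj_on_le[OF _ _ fin])
      show "inj_on (\<lambda>x. x - 1) ?V" using * by (fastforce simp: inj_on_def)
      show "(\<lambda>x. x - 1) ` ?V \<subseteq> U k t" using U_shift[OF k t] * by auto
    qed
  next
    case gap
    have *: "x \<noteq> a" "x < a \<Longrightarrow> x \<in> U k t" "a < x \<Longrightarrow> x - 1 \<in> U k t \<and> a < x - 1"
      if "x \<in> ?V" for x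
    proof -
      show "x \<noteq> a" using U_same[OF k t, of x] that gap by auto
      show "x \<in> U k t" if "x < a" using U_same[OF k t, of x] that \<open>x \<in> ?V\<close> gap by auto
      assume "a < x"
      then have "x - 1 \<in> U k t" using U_shift[OF k t, of x] that gap by auto
      moreover from this have "x - 1 \<noteq> a" using gap by auto
      ultimately show "x - 1 \<in> U k t \<and> a < x - 1" using \<open>a < x\<close> by auto
    qed
    show ?thesis
    proof (rule card_inj_on_le[OF _ _ fin])
      show "inj_on (\<lambda>x. if x < a then x else x - 1) ?V"
      proof (rule inj_onI)
        fix x y assume xy: "x \<in> ?V" "y \<in> ?V"
          "(if x < a then x else x - 1) = (if y < a then y else y - 1)"
        then show "x = y" using *(1,3)[of x] *(1,3)[of y]
          by (cases "x < a"; cases "y < a") (auto simp: not_less le_less)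
      qed
      show "(\<lambda>x. if x < a then x else x - 1) ` ?V \<subseteq> U k t"
      proof (rule image_subsetI)
        fix x assume "x \<in> ?V"
        then show "(if x < a then x else x - 1) \<in> U k t" using *[of x]
          by (metis linorder_neqE_nat)
      qed
    qed
  next
    case full
    let ?l = "Suc k mod 4"
    have l: "?l < 4" "?l \<noteq> k" using k by (auto simp: mod_Suc)
    have ct: "t \<le> card (U k t)" using card_mono[OF fin full(2)] by simp
    have "card (U k t) + card (U ?l t) = (\<Sum>m\<in>{k,?l}. card (U m t))" using l by simp
    also have "\<dots> \<le> unburnt t" unfolding unburnt_def by (rule sum_mono2) (use l k in auto)
    finally have "card (U ?l t) = 0" using le ct by simp
    then have "U ?l t = {}" using U_fin l by simp
    then have "1 \<notin> ?V" using U_axis[OF k t] by auto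
    then have "?V \<subseteq> {2..Suc t}" using U_range[OF k, of _ "Suc t"]
      by (force simp: numeral_2_eq_2 Suc_le_eq le_less)
    then have "card ?V \<le> card {2..Suc t}" by (intro card_mono) auto
    then show ?thesis using ct by simp
  qed
qed

lemma timely_Suc: "timely (Suc t) = timely t + (\<Sum>k<4. card (E k (Suc t)))"
  by (simp add: timely_def)

lemma timely_le: "timely t \<le> t" using budget by (simp add: timely_def)

lemma unburnt_le_timely: "1 \<le> t \<Longrightarrow> unburnt t \<le> timely t"
proof (induction t rule: dec_induct)
  case base
  have "unburnt 1 \<le> (\<Sum>k<4. card (E k 1))" unfolding unburnt_def
    
  proof (rule sum_mono)
    fix k assume "k \<in> {..<4::nat}"
    then show "card (U k 1) \<le> card (E k 1)" using U_start by (intro card_mono E_fin) auto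
  qed
  then show ?case by (simp add: timely_def)
next
  case (step t)
  then have Wt: "unburnt t \<le> t" using timely_le[of t] by simp
  have "unburnt (Suc t) \<le> (\<Sum>k<4. card (U k t) + card (E k (Suc t)))"
    unfolding unburnt_def using step.hyps Wt
    by (intro sum_mono card_U_Suc_le new_unburnt_le) auto
  then show ?case using step.IH by (simp add: timely_Suc unburnt_def sum.distrib)
qed

text \<open>
  Past both walls, each unburnt and unprotected point \<open>x\<close> has both \<open>x\<close> and \<open>x - 1\<close> unburnt on the previous level.
  So the smallest unburnt point of a level does not survive to the next one.
\<close>

lemma new_unburnt_past_walls:
  assumes k: "k < 4" and t: "d k < t" "d (Suc k mod 4) < t"
  shows "card (U k (Suc t)) + (if U k t = {} then 0 else 1) \<le> card (U k t) + card (E k (Suc t))"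
proof -
  let ?V = "U k (Suc t) - E k (Suc t)"
  have fin: "finite (U k t)" using U_fin k by blast
  have t1: "1 \<le> t" using t by simp
  have *: "x \<in> U k t \<and> x - 1 \<in> U k t \<and> 2 \<le> x" if "x \<in> ?V" for x
    using U_range[OF k, of x "Suc t"] t that U_same[OF k t1, of x] U_shift[OF k t1, of x] by auto
  show ?thesis
  proof (cases "U k t = {}")
    case True
    then show ?thesis using card_U_Suc_le[OF k, of t 0] * by (cases "?V = {}") auto
  next
    case False
    have "?V \<subseteq> U k t - {Min (U k t)}"
    proof
      fix x assume "x \<in> ?V"
      from *[OF this] show "x \<in> U k t - {Min (U k t)}" using Min_le[OF fin, of "x - 1"] by auto
    qed
    then have "card ?V \<le> card (U k t - {Min (U k t)})" using fin by (intro card_mono) auto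
    also have "\<dots> = card (U k t) - 1" using fin False by (simp add: Min_in)
    finally have "card ?V \<le> card (U k t) - 1" .
    moreover have "card (U k t) > 0" using fin False by (simp add: card_gt_0_iff)
    ultimately show ?thesis using card_U_Suc_le[OF k, of t "card (U k t) - 1"] False by auto
  qed
qed

lemma card_U_le:
  assumes "k < 4" 
  shows "int (card (U k t)) \<le> max 0 (int (d k) + int (d (Suc k mod 4)) + 1 - int t)"
proof -
  have "U k t \<subseteq> {t - d (Suc k mod 4)..d k}" using U_range[OF assms] by fastforce
  then have "card (U k t) \<le> card {t - d (Suc k mod 4)..d k}" by (intro card_mono) auto
  also have "int \<dots> \<le> max 0 (int (d k) + int (d (Suc k mod 4)) + 1 - int t)" by simp
  finally show ?thesis by simp
qed

end

section \<open>Summation over the levels\<close>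

text \<open>
  The summand \<open>f s\<close> occurs once for each \<open>t\<close> with \<open>s < t \<le> n\<close>.
\<close>

lemma sum_partial_sums:
  fixes f :: "nat \<Rightarrow> int"
  shows "(\<Sum>t\<in>{m<..n}. \<Sum>s\<in>{m<..<t}. f s) = (\<Sum>s\<in>{m<..n}. f s * (int n - int s))"
proof (induction n)
  case 0
  then show ?case by simp
next
  case (Suc n)
  show ?case
  proof (cases "m < Suc n")
    case True
    then have 1: "{m<..Suc n} = insert (Suc n) {m<..n}" by auto
    have 2: "{m<..<Suc n} = {m<..n}" by auto
    show ?thesis using Suc by (simp add: 1 2 algebra_simps flip: sum.distrib)
  qed simp
qed

lemma sum_truncated_descent_le:
  "2 * (\<Sum>r=1..R. max 0 (c - int r)) \<le> (max 0 c)\<^sup>2"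
proof (induction R arbitrary: c)
  case (Suc R)
  have "(\<Sum>r=1..Suc R. max 0 (c - int r)) = max 0 (c - 1) + (\<Sum>r=1..R. max 0 ((c - 1) - int r))"
    by (simp add: sum.atLeast_Suc_atMost sum.shift_bounds_cl_Suc_ivl del: sum.cl_ivl_Suc) (simp add: algebra_simps)
  moreover have "2 * max 0 (c - 1) + (max 0 (c - 1))\<^sup>2 \<le> (max 0 c)\<^sup>2"
    by (cases "c \<ge> 1") (auto simp: max_def power2_eq_square algebra_simps)
  ultimately show ?case using Suc[of "c - 1"] by (smt (verit))
qed simp

lemma two_sum_upto: "2 * (\<Sum>t=1..m. int t) = int m * (int m + 1)"
  by (induction m) (auto simp: algebra_simps)

context four_fronts
begin

definition active :: "nat \<Rightarrow> nat \<Rightarrow> int" where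
  "active k t = (if U k t = {} then 0 else 1)"

text \<open>
  The stock of timely protected vertices pays both for the vertices that are unburnt now and for the
  one that each active quadrant has lost in every step since all walls were passed.
\<close>

lemma unburnt_plus_activity_le:
  assumes d: "\<And>k. k < 4 \<Longrightarrow> d k \<le> M" and "M < t"
  shows "int (unburnt t) + (\<Sum>s\<in>{M<..<t}. \<Sum>k<4. active k s) \<le> int (timely t)"
proof -
  have "Suc M \<le> t" using assms by simp
  then show ?thesis
  proof (induction t rule: dec_induct)
    case base
    have "{M<..<Suc M} = {}" by auto
    then show ?case using unburnt_le_timely[of "Suc M"] by simp
  next
    case (step t)
    have *: "{M<..<Suc t} = insert t {M<..<t}" using step by auto
    have "(\<Sum>k<4. int (card (U k (Suc t))) + active k t)
        \<le> (\<Sum>k<4. int (card (U k t)) + int (card (E k (Suc t))))"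
    proof (rule sum_mono)
      fix k assume "k \<in> {..<4::nat}"
      then have k: "k < 4" by simp
      have "d k < t" "d (Suc k mod 4) < t" using d[OF k] d[of "Suc k mod 4"] step.hyps by auto
      from new_unburnt_past_walls[OF k this]
      show "int (card (U k (Suc t))) + active k t \<le> int (card (U k t)) + int (card (E k (Suc t)))"
        by (auto simp: active_def split: if_splits)
    qed
    then show ?case using step.IH by (simp add: * unburnt_def timely_Suc sum.distrib)
  qed
qed

text \<open>
  For \<open>n\<close> beyond both walls of quadrant \<open>k\<close>, the number of vertices on its level \<open>n\<close>, continued
  linearly to negative values when the quadrant ends before that level.
\<close>

definition excess :: "nat \<Rightarrow> nat \<Rightarrow> int" where
  "excess n k = int (d k) + int (d (Suc k mod 4)) + 1 - int n"

lemma card_U_le_active: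
  assumes "k < 4"
  shows "int (card (U k t)) \<le> active k t * (excess n k + int n - int t)"
proof (cases "U k t = {}")
  case False
  then have "card (U k t) > 0" using U_fin assms by (simp add: card_gt_0_iff)
  then show ?thesis using card_U_le[OF assms, of t] False by (simp add: active_def excess_def)
qed (simp add: active_def)

lemma sum_unburnt_until_walls: "2 * (\<Sum>t=1..M. int (unburnt t)) \<le> int M * (int M + 1)"
proof -
  have "(\<Sum>t=1..M. int (unburnt t)) \<le> (\<Sum>t=1..M. int t)"
  proof (rule sum_mono)
    fix t assume "t \<in> {1..M}"
    then show "int (unburnt t) \<le> int t" using unburnt_le_timely[of t] timely_le[of t] by simp
  qed
  then show ?thesis using two_sum_upto[of M] by simp
qed

text \<open>
  Let \<open>c\<^sub>k = excess n k\<close>, so that level \<open>t\<close> has \<open>c\<^sub>k + n - t\<close> vertices in quadrant \<open>k\<close>. Summing the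
  activity of quadrant \<open>k\<close> at level \<open>s\<close> over all levels \<open>t\<close> with \<open>s < t \<le> n\<close> charges \<open>n - s\<close> for it,
  which is what the level size exceeds \<open>c\<^sub>k\<close> by. When the budget bound and the size bound are
  added, only \<open>c\<^sub>k\<close> remains of each active level.
\<close>

lemma sum_unburnt_between:
  assumes d: "\<And>k. k < 4 \<Longrightarrow> d k \<le> M" and n: "M \<le> n"
  shows "2 * (\<Sum>t\<in>{M<..n}. int (unburnt t))
    \<le> (\<Sum>t\<in>{M<..n}. int t) + (int n - int M) * (\<Sum>k<4. max 0 (excess n k))"
proof -
  let ?A = "\<lambda>s. \<Sum>k<4. active k s"
  have 1: "(\<Sum>t\<in>{M<..n}. int (unburnt t)) \<le> (\<Sum>t\<in>{M<..n}. int t - (\<Sum>s\<in>{M<..<t}. ?A s))"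
  proof (rule sum_mono)
    fix t assume "t \<in> {M<..n}"
    then show "int (unburnt t) \<le> int t - (\<Sum>s\<in>{M<..<t}. ?A s)"
      using unburnt_plus_activity_le[OF d, of t] timely_le[of t] by simp
  qed
  have 2: "(\<Sum>t\<in>{M<..n}. int (unburnt t))
      \<le> (\<Sum>t\<in>{M<..n}. \<Sum>k<4. active k t * (excess n k + int n - int t))"
    unfolding unburnt_def of_nat_sum by (intro sum_mono card_U_le_active) simp
  have "(\<Sum>t\<in>{M<..n}. int t - (\<Sum>s\<in>{M<..<t}. ?A s))
      = (\<Sum>t\<in>{M<..n}. int t) - (\<Sum>t\<in>{M<..n}. \<Sum>k<4. active k t * (int n - int t))"
    by (simp add: sum_subtractf sum_partial_sums sum_distrib_right)
  also have "\<dots> = (\<Sum>t\<in>{M<..n}. int t)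
      - (\<Sum>t\<in>{M<..n}. \<Sum>k<4. active k t * (excess n k + int n - int t))
      + (\<Sum>t\<in>{M<..n}. \<Sum>k<4. active k t * excess n k)"
    by (simp add: algebra_simps sum.distrib sum_subtractf)
  finally have "2 * (\<Sum>t\<in>{M<..n}. int (unburnt t))
      \<le> (\<Sum>t\<in>{M<..n}. int t) + (\<Sum>t\<in>{M<..n}. \<Sum>k<4. active k t * excess n k)"
    using 1 2 by linarith
  also have "(\<Sum>t\<in>{M<..n}. \<Sum>k<4. active k t * excess n k)
      \<le> (\<Sum>t\<in>{M<..n}. \<Sum>k<4. max 0 (excess n k))"
    by (intro sum_mono) (auto simp: active_def)
  finally show ?thesis using n by (simp add: of_nat_diff)
qed

lemma sum_unburnt_late: "2 * (\<Sum>r=1..R. int (unburnt (n + r))) \<le> (\<Sum>k<4. (max 0 (excess n k))\<^sup>2)"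
proof -
  have "(\<Sum>r=1..R. int (unburnt (n + r))) \<le> (\<Sum>r=1..R. \<Sum>k<4. max 0 (excess n k - int r))"
    unfolding unburnt_def of_nat_sum
  proof (intro sum_mono)
    fix r k assume "k \<in> {..<4::nat}"
    then show "int (card (U k (n + r))) \<le> max 0 (excess n k - int r)"
      using card_U_le[of k "n + r"] by (simp add: excess_def algebra_simps)
  qed
  also have "\<dots> = (\<Sum>k<4. \<Sum>r=1..R. max 0 (excess n k - int r))" by (rule sum.swap)
  finally have "2 * (\<Sum>r=1..R. int (unburnt (n + r))) \<le> 2 * (\<Sum>k<4. \<Sum>r=1..R. max 0 (excess n k - int r))"
    by (rule mult_left_mono) simp
  also have "\<dots> = (\<Sum>k<4. 2 * (\<Sum>r=1..R. max 0 (excess n k - int r)))"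
    by (rule sum_distrib_left)
  also have "\<dots> \<le> (\<Sum>k<4. (max 0 (excess n k))\<^sup>2)"
    by (intro sum_mono sum_truncated_descent_le)
  finally show ?thesis .
qed

text \<open>
  The bound of the three phases, up to \<open>M\<close>, up to \<open>n\<close> and beyond. Opposite quadrants have opposite
  excess, which is why the positive parts add up to \<open>2M - N\<close> and their squares to a polynomial.
\<close>

lemma sum_unburnt_le:
  assumes "d 0 + d 2 = N" "d 1 + d 3 = N" and n: "n = Suc N"
    and b: "b = min (min (d 0) (d 1)) (min (d 2) (d 3))"
  shows "4 * (\<Sum>t=1..2 * n. int (unburnt t)) \<le> 2 * (int n)\<^sup>2 + 2 * int n - 3 * (int b)\<^sup>2
     + 2 * ((int N - int (d 0) - int (d 1))\<^sup>2 + (int (d 0) - int (d 1))\<^sup>2)"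
proof -
  define M where "M = N - b"
  have bN: "b \<le> N" and M: "int M = int N - int b" using assms by (auto simp: M_def)
  have dM: "d k \<le> M" if "k < 4" for k
  proof -
    have "k = 0 \<or> k = 1 \<or> k = 2 \<or> k = 3" using that by auto
    then show ?thesis using assms unfolding M_def by auto
  qed
  have S4: "(\<Sum>k<4. f k) = f 0 + f 1 + f 2 + f 3" for f :: "nat \<Rightarrow> int"
    by (simp add: eval_nat_numeral)
  have exc: "excess n 0 = int (d 0) + int (d 1) - int N" "excess n 1 = int (d 1) - int (d 0)"
    "excess n 2 = - excess n 0" "excess n 3 = - excess n 1"
  proof -
    have m4: "Suc 0 mod 4 = 1" "Suc 1 mod 4 = 2" "Suc 2 mod 4 = 3" "Suc 3 mod 4 = (0::nat)" by simp_all
    have e: "excess n 0 = int (d 0) + int (d 1) - int N" "excess n 1 = int (d 1) + int (d 2) - int N"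
      "excess n 2 = int (d 2) + int (d 3) - int N" "excess n 3 = int (d 3) + int (d 0) - int N"
      unfolding excess_def n m4 by simp_all
    have N: "int N = int (d 0) + int (d 2)" "int N = int (d 1) + int (d 3)" using assms(1,2) by simp_all
    show "excess n 0 = int (d 0) + int (d 1) - int N" by (fact e(1))
    show "excess n 1 = int (d 1) - int (d 0)" "excess n 2 = - excess n 0" "excess n 3 = - excess n 1"
      unfolding e using N by linarith+
  qed
  have sum1: "(\<Sum>k<4. max 0 (excess n k)) = 2 * int M - int N"
    unfolding S4 exc(3,4) unfolding exc M using assms(1,2) b by (simp add: max_def min_def)
  have sq: "(max 0 a)\<^sup>2 + (max 0 (-a))\<^sup>2 = a\<^sup>2" for a :: int by (auto simp: max_def)
  have sum2: "(\<Sum>k<4. (max 0 (excess n k))\<^sup>2)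
      = (int N - int (d 0) - int (d 1))\<^sup>2 + (int (d 0) - int (d 1))\<^sup>2"
  proof -
    have "(\<Sum>k<4. (max 0 (excess n k))\<^sup>2) = (excess n 0)\<^sup>2 + (excess n 1)\<^sup>2"
      unfolding S4 exc(3,4) using sq[of "excess n 0"] sq[of "excess n 1"] by linarith
    then show ?thesis unfolding exc by (simp add: power2_eq_square algebra_simps)
  qed
  have Mn: "M \<le> n" using n by (simp add: M_def)
  have cut: "sum f {1..q} = sum f {1..p} + sum f {p<..q}" if "p \<le> q" for f :: "nat \<Rightarrow> int" and p q
  proof -
    have "{1..q} = {1..p} \<union> {p<..q}" using that by auto
    moreover have "sum f ({1..p} \<union> {p<..q}) = sum f {1..p} + sum f {p<..q}"
      by (rule sum.union_disjoint) auto
    ultimately show ?thesis by simp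
  qed
  have "(\<Sum>t=1..2 * n. int (unburnt t))
      = (\<Sum>t=1..M. int (unburnt t)) + (\<Sum>t\<in>{M<..n}. int (unburnt t)) + (\<Sum>t\<in>{n<..2 * n}. int (unburnt t))"
    using cut[of M n] cut[of n "2 * n"] Mn by simp
  also have "(\<Sum>t\<in>{n<..2 * n}. int (unburnt t)) = (\<Sum>r=1..n. int (unburnt (n + r)))"
    by (rule sum.reindex_bij_witness[of _ "\<lambda>r. n + r" "\<lambda>t. t - n"]) auto
  finally have split: "(\<Sum>t=1..2 * n. int (unburnt t)) = (\<Sum>t=1..M. int (unburnt t)) + (\<Sum>t\<in>{M<..n}. int (unburnt t))
      + (\<Sum>r=1..n. int (unburnt (n + r)))" .
  have mid: "2 * (\<Sum>t\<in>{M<..n}. int t) = int n * (int n + 1) - int M * (int M + 1)"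
    using two_sum_upto[of n] two_sum_upto[of M] cut[OF Mn, of int] by simp
  have "4 * (\<Sum>t=1..2 * n. int (unburnt t)) \<le> int M * (int M + 1) + int n * (int n + 1)
      + 2 * ((int n - int M) * (2 * int M - int N))
      + 2 * ((int N - int (d 0) - int (d 1))\<^sup>2 + (int (d 0) - int (d 1))\<^sup>2)"
  proof -
    have "2 * (\<Sum>t\<in>{M<..n}. int (unburnt t))
        \<le> (\<Sum>t\<in>{M<..n}. int t) + (int n - int M) * (\<Sum>k<4. max 0 (excess n k))"
      by (rule sum_unburnt_between) (use dM Mn in auto)
    moreover define P Q R S where "P = (int n - int M) * (2 * int M - int N)"
      and "Q = int M * (int M + 1)" and "R = int n * (int n + 1)"
      and "S = (int N - int (d 0) - int (d 1))\<^sup>2 + (int (d 0) - int (d 1))\<^sup>2"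
    ultimately show ?thesis using sum_unburnt_until_walls[of M] sum_unburnt_late[of n n] mid
      unfolding split sum1 sum2 P_def[symmetric] Q_def[symmetric] R_def[symmetric] S_def[symmetric] by (simp add: algebra_simps)
  qed
  also have "int M * (int M + 1) + int n * (int n + 1) + 2 * ((int n - int M) * (2 * int M - int N))
     = 2 * (int n)\<^sup>2 + 2 * int n - 3 * (int b + 1)\<^sup>2 + (int b + 1)"
    unfolding M n by (simp add: power2_eq_square algebra_simps)
  also have "\<dots> \<le> 2 * (int n)\<^sup>2 + 2 * int n - 3 * (int b)\<^sup>2"
    by (simp add: power2_eq_square algebra_simps)
  finally show ?thesis by simp
qed

end

section \<open>The upper bound for one outbreak\<close>

abbreviation grid :: "nat \<Rightarrow> (nat \<times> nat) pair_pre_digraph" where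
  "grid n \<equiv> path_graph n \<box> path_graph n"

lemma pverts_grid: "pverts (grid n) = {..<n} \<times> {..<n}"
  by (simp add: box_product_def path_graph_def)

lemma arc_grid_iff: "((a, b), (a', b')) \<in> parcs (grid n) \<longleftrightarrow> a < n \<and> b < n \<and> a' < n \<and> b' < n \<and>
    (a = a' \<and> (b' = Suc b \<or> b = Suc b') \<or> b = b' \<and> (a' = Suc a \<or> a = Suc a'))"
  by (auto simp: box_product_def path_graph_def)

definition l1_dist :: "nat \<times> nat \<Rightarrow> nat \<times> nat \<Rightarrow> nat" where
  "l1_dist v w = nat \<bar>int (fst w) - int (fst v)\<bar> + nat \<bar>int (snd w) - int (snd v)\<bar>"

definition wall_dist :: "nat \<Rightarrow> nat \<Rightarrow> nat \<Rightarrow> nat \<Rightarrow> nat" where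
  "wall_dist N i j k = (if k = 0 then N - i else if k = 1 then N - j else if k = 2 then i else j)"

text \<open>
  The \<open>k\<close>-fold rotation by a right angle about \<open>(i, j)\<close> of the point \<open>(i + x, j + y)\<close>. In quadrant \<open>k\<close>
  the coordinate \<open>x\<close> runs towards the side at distance \<open>wall_dist N i j k\<close> and \<open>y\<close> towards the side next
  in the order of rotation.
\<close>

definition embed :: "nat \<Rightarrow> nat \<Rightarrow> nat \<Rightarrow> nat \<Rightarrow> nat \<Rightarrow> nat \<times> nat" where
  "embed i j k x y =
     (if k = 0 then (i + x, j + y) else if k = 1 then (i - y, j + x)
      else if k = 2 then (i - x, j - y) else (i + y, j - x))"

lemma less_4_cases: "k < (4::nat) \<Longrightarrow> k = 0 \<or> k = 1 \<or> k = 2 \<or> k = 3"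
  by auto

context
  fixes N i j :: nat
  assumes i: "i \<le> N" and j: "j \<le> N"
begin

abbreviation "walls \<equiv> wall_dist N i j"
abbreviation "emb \<equiv> embed i j"

lemma wall_dist_simps:
  "walls 0 = N - i" "walls (Suc 0) = N - j" "walls 2 = i" "walls 3 = j" "walls (Suc (Suc 0)) = i"
  by (simp_all add: wall_dist_def)

lemma embed_simps:
  "emb 0 x y = (i + x, j + y)" "emb (Suc 0) x y = (i - y, j + x)"
  "emb 2 x y = (i - x, j - y)" "emb 3 x y = (i + y, j - x)"
  by (simp_all add: embed_def)

lemma embed_in_grid:
  assumes "k < 4" "x \<le> walls k" "y \<le> walls (Suc k mod 4)"
  shows "emb k x y \<in> pverts (grid (Suc N))"
  using less_4_cases[OF assms(1)] assms(2,3) i j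
  by (elim disjE) (auto simp: pverts_grid embed_def wall_dist_def)

lemma l1_dist_embed:
  assumes "k < 4" "x \<le> walls k" "y \<le> walls (Suc k mod 4)"
  shows "l1_dist (i, j) (emb k x y) = x + y"
  using less_4_cases[OF assms(1)] assms(2,3) i j
  by (elim disjE) (simp_all add: embed_def wall_dist_def l1_dist_def of_nat_diff)

lemma embed_arc_x:
  assumes "k < 4" "Suc x \<le> walls k" "y \<le> walls (Suc k mod 4)"
  shows "(emb k x y, emb k (Suc x) y) \<in> parcs (grid (Suc N))"
  using less_4_cases[OF assms(1)] assms(2,3) i j
  by (elim disjE) (auto simp: embed_def wall_dist_def arc_grid_iff)

lemma embed_arc_y:
  assumes "k < 4" "x \<le> walls k" "Suc y \<le> walls (Suc k mod 4)"
  shows "(emb k x y, emb k x (Suc y)) \<in> parcs (grid (Suc N))"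
  using less_4_cases[OF assms(1)] assms(2,3) i j
  by (elim disjE) (auto simp: embed_def wall_dist_def arc_grid_iff)

lemma embed_turn: "k < 4 \<Longrightarrow> emb k 0 y = emb (Suc k mod 4) y 0"
  by (drule less_4_cases) (elim disjE; simp add: embed_def)

text \<open>
  The quadrants are half open, so each vertex other than \<open>(i, j)\<close> lies in exactly one and determines
  its quadrant and its local coordinates.
\<close>

lemma embed_inj:
  assumes "k < 4" "1 \<le> x" "x \<le> walls k" "y \<le> walls (Suc k mod 4)"
    and "k' < 4" "1 \<le> x'" "x' \<le> walls k'" "y' \<le> walls (Suc k' mod 4)"
    and "emb k x y = emb k' x' y'"
  shows "k = k' \<and> x = x' \<and> y = y'"
proof -
  define decode where "decode = (\<lambda>(a, b). if a > i \<and> b \<ge> j then (0::nat, a - i, b - j)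
    else if b > j \<and> a \<le> i then (1, b - j, i - a)
    else if a < i \<and> b \<le> j then (2, i - a, j - b) else (3, j - b, a - i))"
  have dec: "decode (emb k x y) = (k, x, y)" if "k < 4" "1 \<le> x" "x \<le> walls k" "y \<le> walls (Suc k mod 4)" for k x y
    using less_4_cases[OF that(1)]
  proof (elim disjE)
    assume k: "k = 0"
    show ?thesis using that i j unfolding k by (simp add: decode_def embed_simps wall_dist_simps)
  next
    assume k: "k = 1"
    show ?thesis using that i j unfolding k by (simp add: decode_def embed_simps wall_dist_simps)
  next
    assume k: "k = 2"
    show ?thesis using that i j unfolding k by (auto simp: decode_def embed_simps wall_dist_simps)
  next
    assume k: "k = 3"
    show ?thesis using that i j unfolding k by (auto simp: decode_def embed_simps wall_dist_simps)
  qed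
  have "(k, x, y) = decode (emb k x y)" by (rule dec[symmetric]) (fact assms)+
  also have "\<dots> = decode (emb k' x' y')" by (rule arg_cong[of _ _ decode]) (fact assms)
  also have "\<dots> = (k', x', y')" by (rule dec) (fact assms)+
  finally show ?thesis by blast
qed

lemma embed_cover:
  assumes "w \<in> pverts (grid (Suc N))" "w \<noteq> (i, j)"
  shows "\<exists>k<4. \<exists>x y. 1 \<le> x \<and> x \<le> walls k \<and> y \<le> walls (Suc k mod 4) \<and> w = emb k x y"
proof -
  obtain a b where w: "w = (a, b)" "a \<le> N" "b \<le> N" using assms(1) by (cases w) (auto simp: pverts_grid)
  have "a > i \<and> b \<ge> j \<or> a \<le> i \<and> b > j \<or> a < i \<and> b \<le> j \<or> a \<ge> i \<and> b < j" using assms(2) w by auto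
  moreover have I: ?thesis if "k < 4" "1 \<le> x" "x \<le> walls k" "y \<le> walls (Suc k mod 4)" "w = emb k x y" for k x y
    using that by blast
  ultimately show ?thesis
  proof (elim disjE conjE)
    assume "a > i" "b \<ge> j"
    then show ?thesis using w by (intro I[of 0 "a - i" "b - j"]) (simp_all add: embed_simps wall_dist_simps)
  next
    assume "a \<le> i" "b > j"
    then show ?thesis using w i by (intro I[of 1 "b - j" "i - a"]) (simp_all add: embed_simps wall_dist_simps)
  next
    assume "a < i" "b \<le> j"
    then show ?thesis using w by (intro I[of 2 "i - a" "j - b"]) (simp_all add: embed_simps wall_dist_simps)
  next
    assume "a \<ge> i" "b < j"
    then show ?thesis using w by (intro I[of 3 "j - b" "a - i"]) (simp_all add: embed_simps wall_dist_simps)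
  qed
qed

definition front_part :: "(nat \<times> nat) set \<Rightarrow> nat \<Rightarrow> nat \<Rightarrow> nat set" where
  "front_part S k t = {x. 1 \<le> x \<and> x \<le> t \<and> x \<le> walls k \<and> t \<le> x + walls (Suc k mod 4) \<and> emb k x (t - x) \<in> S}"

lemma finite_front_part: "finite (front_part S k t)"
  by (rule finite_subset[of _ "{..t}"]) (auto simp: front_part_def)

lemma sum_card_front_part_le:
  assumes "finite S"
  shows "(\<Sum>s=1..t. \<Sum>k<4. card (front_part S k s)) \<le> card {w \<in> S. l1_dist (i, j) w \<le> t}"
proof -
  let ?I = "SIGMA s:{1..t}. SIGMA k:{..<4}. front_part S k s"
  have "(\<Sum>s=1..t. \<Sum>k<4. card (front_part S k s)) = card ?I"
    by (simp add: finite_front_part)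
  also have "\<dots> \<le> card {w \<in> S. l1_dist (i, j) w \<le> t}"
  proof (rule card_inj_on_le)
    show "inj_on (\<lambda>(s, k, x). emb k x (s - x)) ?I"
    proof (rule inj_onI)
      fix p p' assume p: "p \<in> ?I" "p' \<in> ?I"
        and e: "(\<lambda>(s, k, x). emb k x (s - x)) p = (\<lambda>(s, k, x). emb k x (s - x)) p'"
      obtain s k x s' k' x' where pp: "p = (s, k, x)" "p' = (s', k', x')"
        by (metis prod_cases3)
      have "k = k' \<and> x = x' \<and> s - x = s' - x'"
        by (rule embed_inj) (use p e in \<open>auto simp: pp front_part_def\<close>)
      moreover have "x \<le> s" "x' \<le> s'" using p by (auto simp: pp front_part_def)
      ultimately have "k = k'" "x = x'" "s = s'" by linarith+
      then show "p = p'" by (simp add: pp)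
    qed
    show "(\<lambda>(s, k, x). emb k x (s - x)) ` ?I \<subseteq> {w \<in> S. l1_dist (i, j) w \<le> t}"
      by (auto simp: front_part_def l1_dist_embed)
    show "finite {w \<in> S. l1_dist (i, j) w \<le> t}" using assms by simp
  qed
  finally show ?thesis .
qed

lemma card_le_sum_front_part:
  assumes "S \<subseteq> pverts (grid (Suc N))" "(i, j) \<notin> S"
  shows "card S \<le> (\<Sum>t=1..2 * Suc N. \<Sum>k<4. card (front_part S k t))"
proof -
  let ?I = "SIGMA t:{1..2 * Suc N}. SIGMA k:{..<4}. front_part S k t"
  have "card S \<le> card ?I"
  proof (rule surj_card_le)
    show "finite ?I" by (simp add: finite_front_part)
    show "S \<subseteq> (\<lambda>(t, k, x). emb k x (t - x)) ` ?I"
    proof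
      fix w assume w: "w \<in> S"
      then obtain k x y where k: "k < 4" "1 \<le> x" "x \<le> walls k" "y \<le> walls (Suc k mod 4)" "w = emb k x y"
        using embed_cover[of w] assms by blast
      have "walls k \<le> N" "walls (Suc k mod 4) \<le> N" using i j by (auto simp: wall_dist_def)
      then have "(x + y, k, x) \<in> ?I" using k w by (auto simp: front_part_def)
      then show "w \<in> (\<lambda>(t, k, x). emb k x (t - x)) ` ?I"
        using k by (intro image_eqI[of _ _ "(x + y, k, x)"]) auto
    qed
  qed
  also have "card ?I = (\<Sum>t=1..2 * Suc N. \<Sum>k<4. card (front_part S k t))"
    by (simp add: finite_front_part)
  finally show ?thesis .
qed

lemma four_fronts_grid:
  assumes v: "(i, j) \<in> F"
    and spread: "\<And>u w. u \<in> F \<Longrightarrow> w \<in> pverts (grid (Suc N)) \<Longrightarrow> (u, w) \<in> parcs (grid (Suc N)) \<Longrightarrow>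
       l1_dist (i, j) w = Suc (l1_dist (i, j) u) \<Longrightarrow> w \<notin> E \<Longrightarrow> w \<in> F"
    and budget: "\<And>t. card {w \<in> E. l1_dist (i, j) w \<le> t} \<le> t" and fin: "finite E"
  shows "four_fronts walls (front_part (- F)) (front_part E)"
proof
  have next_x: "emb k (Suc x) y \<in> F \<or> emb k (Suc x) y \<in> E"
    if "k < 4" "Suc x \<le> walls k" "y \<le> walls (Suc k mod 4)" "emb k x y \<in> F" for k x y
    using spread[OF that(4) embed_in_grid embed_arc_x] that by (auto simp: l1_dist_embed)
  have next_y: "emb k x (Suc y) \<in> F \<or> emb k x (Suc y) \<in> E"
    if "k < 4" "x \<le> walls k" "Suc y \<le> walls (Suc k mod 4)" "emb k x y \<in> F" for k x y
    using spread[OF that(4) embed_in_grid embed_arc_y] that by (auto simp: l1_dist_embed)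
  fix k t x :: nat
  show "finite (front_part E k t)" by (rule finite_front_part)
  show "(\<Sum>s=1..t. \<Sum>k<4. card (front_part E k s)) \<le> t"
    using sum_card_front_part_le[OF fin, of t] budget[of t] by simp
  assume k: "k < 4"
  show "1 \<le> x \<and> x \<le> t \<and> x \<le> walls k \<and> t \<le> x + walls (Suc k mod 4)" if "x \<in> front_part (- F) k t"
    using that by (simp add: front_part_def)
  show "front_part (- F) k 1 \<subseteq> front_part E k 1"
  proof
    fix x assume x: "x \<in> front_part (- F) k 1"
    then have "x = 1" by (simp add: front_part_def)
    have "emb k 0 0 = (i, j)" by (simp add: embed_def)
    then show "x \<in> front_part E k 1" using next_x[of k 0 0] x k v \<open>x = 1\<close>
      by (auto simp: front_part_def)
  qed
  assume t: "1 \<le> t"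
  show "x \<in> front_part (- F) k t"
    if x: "x \<in> front_part (- F) k (Suc t)" "x \<notin> front_part E k (Suc t)" "x \<le> t"
  proof -
    have "Suc (t - x) \<le> walls (Suc k mod 4)" using x by (auto simp: front_part_def)
    then show ?thesis
      using next_y[of k x "t - x"] x k by (auto simp: front_part_def Suc_diff_le)
  qed
  show "x - 1 \<in> front_part (- F) k t"
    if x: "x \<in> front_part (- F) k (Suc t)" "x \<notin> front_part E k (Suc t)" "2 \<le> x"
  proof -
    have "Suc t - x \<le> walls (Suc k mod 4)" using x by (auto simp: front_part_def)
    then show ?thesis
      using next_x[of k "x - 1" "Suc t - x"] x k by (auto simp: front_part_def)
  qed
  show "t \<in> front_part (- F) (Suc k mod 4) t"
    if "1 \<in> front_part (- F) k (Suc t)" "1 \<notin> front_part E k (Suc t)"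
    using next_x[of k 0 t] that k t by (auto simp: front_part_def embed_turn)
qed

lemma sn_grid_upper:
  assumes b: "b = min (min i (N - i)) (min j (N - j))"
  defines "n \<equiv> Suc N"
  shows "4 * int (sn (grid n) (i, j)) \<le> 2 * (int n)\<^sup>2 + 2 * int n - 3 * (int b)\<^sup>2
     + 2 * ((int N - int i - int j)\<^sup>2 + (int i - int j)\<^sup>2)"
proof -
  have finG: "finite (pverts (grid n))" by (simp add: pverts_grid)
  obtain B D where fp: "final_position (grid n) (i, j) B D"
    and sn: "sn (grid n) (i, j) = card (pverts (grid n) - B)"
    using sn_attained(1)[OF finG] by blast
  have "l1_dist (i, j) (i, j) = 0" by (simp add: l1_dist_def)
  then obtain F E where F: "(i, j) \<in> F" "F \<subseteq> B"
    "\<And>u w. u \<in> F \<Longrightarrow> w \<in> pverts (grid n) \<Longrightarrow> (u, w) \<in> parcs (grid n) \<Longrightarrow>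
       l1_dist (i, j) w = Suc (l1_dist (i, j) u) \<Longrightarrow> w \<notin> E \<Longrightarrow> w \<in> F"
    "\<And>t. card {w \<in> E. l1_dist (i, j) w \<le> t} \<le> t" "finite E"
    using fast_fire[where dst = "l1_dist (i, j)", OF fp, of thesis] by blast
  interpret four_fronts walls "front_part (- F)" "front_part E"
    by (rule four_fronts_grid[OF F(1) F(3)[unfolded n_def] F(4,5)])
  let ?S = "pverts (grid n) - F"
  have "card (pverts (grid n) - B) \<le> card ?S"
    by (rule card_mono) (use F(2) finG in auto)
  also have "\<dots> \<le> (\<Sum>t=1..2 * Suc N. \<Sum>k<4. card (front_part ?S k t))"
    by (rule card_le_sum_front_part) (use F(1) in \<open>auto simp: n_def\<close>)
  also have "\<dots> \<le> (\<Sum>t=1..2 * Suc N. unburnt t)" unfolding unburnt_def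
    by (intro sum_mono card_mono finite_front_part) (auto simp: front_part_def)
  finally have "sn (grid n) (i, j) \<le> (\<Sum>t=1..2 * n. unburnt t)"
    using sn by (simp only: n_def)
  then have "int (sn (grid n) (i, j)) \<le> (\<Sum>t=1..2 * n. int (unburnt t))"
    unfolding of_nat_sum[symmetric] by (simp only: of_nat_le_iff)
  moreover have "4 * (\<Sum>t=1..2 * n. int (unburnt t)) \<le> 2 * (int n)\<^sup>2 + 2 * int n - 3 * (int b)\<^sup>2
     + 2 * ((int N - int (walls 0) - int (walls 1))\<^sup>2 + (int (walls 0) - int (walls 1))\<^sup>2)"
  proof (rule sum_unburnt_le)
    show "walls 0 + walls 2 = N" "walls 1 + walls 3 = N" using i j by (simp_all add: wall_dist_simps)
    show "n = Suc N" by (simp add: n_def)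
    show "b = min (min (walls 0) (walls 1)) (min (walls 2) (walls 3))"
      unfolding b by (simp add: wall_dist_simps min.assoc min.commute min.left_commute)
  qed
  moreover have "int N - int (walls 0) - int (walls 1) = - (int N - int i - int j)"
    "int (walls 0) - int (walls 1) = - (int i - int j)"
    using i j by (simp_all add: wall_dist_simps of_nat_diff)
  ultimately show ?thesis by (simp only: power2_minus)
qed

end

section \<open>Strategies and symmetries\<close>

text \<open>
  A sufficient criterion for keeping the fire inside \<open>R\<close>: the vertices of \<open>c\<close> are protected one
  after the other, \<open>c s\<close> in turn \<open>s + 1\<close>, and each exit \<open>w\<close> from \<open>R\<close> has its turn no later than
  \<open>dst w\<close>, where \<open>dst\<close> is any lower bound on the time that the fire takes. The sequence may repeat
  vertices, so that turns can be passed.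
\<close>

lemma sn_ge_confined:
  fixes dst :: "'a \<Rightarrow> nat"
  assumes fin: "finite (pverts G)" and R: "R \<subseteq> pverts G" "v \<in> R" and v: "dst v = 0"
    and dst: "\<And>u w. (u, w) \<in> parcs G \<Longrightarrow> dst w \<le> Suc (dst u)"
    and c: "\<And>t. c t \<in> pverts G - R"
    and cut: "\<And>u w. u \<in> R \<Longrightarrow> w \<in> pverts G - R \<Longrightarrow> (u, w) \<in> parcs G \<Longrightarrow> \<exists>s<dst w. c s = w"
  shows "card (pverts G - R) \<le> sn G v"
proof -
  \<comment> \<open>A turn in which nothing catches fire ends the game, so before that the fire grows by a vertex per turn.\<close>
  have "\<exists>B D. reachable_position G v B D \<and> B \<subseteq> R \<and>
      (threatened G B D = {} \<or> D = c ` {..<T} \<and> (\<forall>u\<in>B. dst u \<le> T) \<and> T < card B)" for T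
  proof (induction T)
    case 0
    show ?case
      by (rule exI[of _ "{v}"], rule exI[of _ "{}"]) (simp add: outbreak R v)
  next
    case (Suc T)
    then obtain B D where BD: "reachable_position G v B D" "B \<subseteq> R"
      "threatened G B D = {} \<or> D = c ` {..<T} \<and> (\<forall>u\<in>B. dst u \<le> T) \<and> T < card B" by blast
    show ?case
    proof (cases "threatened G B D = {}")
      case True
      then show ?thesis using BD by blast
    next
      case False
      then have D: "D = c ` {..<T}" and B: "\<And>u. u \<in> B \<Longrightarrow> dst u \<le> T" "T < card B" using BD by auto
      let ?D = "insert (c T) D" and ?N = "threatened G B (insert (c T) D)"
      let ?B = "B \<union> ?N"
      have r: "reachable_position G v ?B ?D"
        by (rule turn[OF BD(1) False]) (use c BD(2) in blast)
      have D': "?D = c ` {..<Suc T}" by (simp add: D lessThan_Suc)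
      have new: "w \<in> R \<and> dst w \<le> Suc T" if w: "w \<in> ?N" for w
      proof -
        obtain u where u: "u \<in> B" "(u, w) \<in> parcs G" "w \<in> pverts G" "w \<notin> ?D"
          using w unfolding threatened_def by blast
        have le: "dst w \<le> Suc T" using dst[OF u(2)] B(1)[OF u(1)] by simp
        moreover have "w \<in> R"
        proof (rule ccontr)
          assume "w \<notin> R"
          then obtain s where "s < dst w" "c s = w" using cut[of u w] u BD(2) by blast
          then have "w \<in> ?D" using le unfolding D' by auto
          then show False using u(4) by blast
        qed
        ultimately show ?thesis by blast
      qed
      have sub: "?B \<subseteq> R" using new BD(2) by blast
      have time: "\<forall>u\<in>?B. dst u \<le> Suc T" using new B(1) by (auto intro: le_SucI)
      show ?thesis
      proof (cases "?N = {}")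
        case True
        then have "threatened G ?B ?D = {}" by simp
        then show ?thesis using r sub by blast
      next
        case False
        have "finite ?B" using sub R(1) fin by (meson finite_subset)
        moreover have "B \<subset> ?B" using False unfolding threatened_def by blast
        ultimately have "card B < card ?B" by (rule psubset_card_mono)
        then have "Suc T < card ?B" using B(2) by simp
        then show ?thesis using r sub time D' by blast
      qed
    qed
  qed
  from this[of "card (pverts G)"] obtain B D where BD: "reachable_position G v B D" "B \<subseteq> R"
      "threatened G B D = {} \<or> card (pverts G) < card B" by blast
  have "card B \<le> card (pverts G)" using BD(2) R(1) fin by (intro card_mono) auto
  then have "final_position G v B D" using BD by (simp add: final_position_def)
  then have "card (pverts G - B) \<le> sn G v" by (rule sn_attained(2)[OF fin])
  moreover have "card (pverts G - R) \<le> card (pverts G - B)"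
    by (rule card_mono) (use fin BD(2) in auto)
  ultimately show ?thesis by simp
qed

lemma sn_automorphism_le:
  assumes fin: "finite (pverts G)" and v: "v \<in> pverts G"
    and inj: "inj_on f (pverts G)" and img: "f ` pverts G = pverts G"
    and arcs: "\<And>u w. u \<in> pverts G \<Longrightarrow> w \<in> pverts G \<Longrightarrow> (f u, f w) \<in> parcs G \<longleftrightarrow> (u, w) \<in> parcs G"
  shows "sn G v \<le> sn G (f v)"
proof -
  have thr: "threatened G (f ` B) (f ` D) = f ` threatened G B D"
    if BD: "B \<subseteq> pverts G" "D \<subseteq> pverts G" for B D
  proof -
    have iff: "f w \<in> threatened G (f ` B) (f ` D) \<longleftrightarrow> w \<in> threatened G B D" if w: "w \<in> pverts G" for w
    proof -
      have "f w \<in> pverts G" using w img by blast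
      moreover have "f w \<in> f ` B \<longleftrightarrow> w \<in> B" "f w \<in> f ` D \<longleftrightarrow> w \<in> D"
        using inj_on_image_mem_iff[OF inj w] BD by auto
      moreover have "(\<exists>u\<in>f ` B. (u, f w) \<in> parcs G) \<longleftrightarrow> (\<exists>u\<in>B. (u, w) \<in> parcs G)"
        using arcs[OF _ w] BD(1) by (auto simp: subset_iff)
      ultimately show ?thesis using w by (simp add: threatened_def)
    qed
    have sub: "threatened G B' D' \<subseteq> pverts G" for B' D' by (auto simp: threatened_def)
    show ?thesis
    proof
      show "threatened G (f ` B) (f ` D) \<subseteq> f ` threatened G B D"
      proof
        fix z assume z: "z \<in> threatened G (f ` B) (f ` D)"
        then have "z \<in> f ` pverts G" using sub img by auto
        then obtain w where "w \<in> pverts G" "z = f w" by auto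
        then show "z \<in> f ` threatened G B D" using iff[of w] z by auto
      qed
      show "f ` threatened G B D \<subseteq> threatened G (f ` B) (f ` D)"
      proof (rule image_subsetI)
        fix w assume w: "w \<in> threatened G B D"
        then have "w \<in> pverts G" using sub by auto
        then show "f w \<in> threatened G (f ` B) (f ` D)" using iff w by auto
      qed
    qed
  qed
  have reach: "B \<subseteq> pverts G \<and> D \<subseteq> pverts G \<and> reachable_position G (f v) (f ` B) (f ` D)"
    if "reachable_position G v B D" for B D
    using that
  proof induction
    case outbreak
    then show ?case using v by (simp add: reachable_position.outbreak)
  next
    case (turn B D x)
    have x: "x \<in> pverts G" "x \<notin> B" using turn.hyps by auto
    have BD: "B \<subseteq> pverts G" "D \<subseteq> pverts G" "insert x D \<subseteq> pverts G" using turn.IH x by auto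
    have "reachable_position G (f v) (f ` B \<union> threatened G (f ` B) (insert (f x) (f ` D))) (insert (f x) (f ` D))"
    proof (rule reachable_position.turn)
      show "reachable_position G (f v) (f ` B) (f ` D)" using turn.IH by blast
      show "threatened G (f ` B) (f ` D) \<noteq> {}" using turn.hyps(2) by (simp add: thr BD)
      show "f x \<in> pverts G - f ` B" using x img inj_on_image_mem_iff[OF inj x(1) BD(1)] by auto
    qed
    then have "reachable_position G (f v) (f ` (B \<union> threatened G B (insert x D))) (f ` insert x D)"
      using thr[OF BD(1,3)] by (simp add: image_Un)
    moreover have "threatened G B (insert x D) \<subseteq> pverts G" unfolding threatened_def by blast
    ultimately show ?case using BD by blast
  qed
  obtain B D where fp: "final_position G v B D" and s: "sn G v = card (pverts G - B)"
    using sn_attained(1)[OF fin] by blast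
  have BD: "B \<subseteq> pverts G" "D \<subseteq> pverts G" "reachable_position G (f v) (f ` B) (f ` D)"
    using reach fp by (auto simp: final_position_def)
  have "final_position G (f v) (f ` B) (f ` D)"
    using BD fp by (simp add: final_position_def thr)
  then have "card (pverts G - f ` B) \<le> sn G (f v)" by (rule sn_attained(2)[OF fin])
  moreover have "pverts G - f ` B = f ` (pverts G - B)"
    using inj_on_image_set_diff[OF inj, of "pverts G" B] BD img by auto
  moreover have "card (f ` (pverts G - B)) = card (pverts G - B)"
    by (rule card_image) (use inj in \<open>auto intro: inj_on_subset\<close>)
  ultimately show ?thesis using s by simp
qed

section \<open>The lower bound for one outbreak\<close>

text \<open>
  The height of the V over column \<open>x\<close>. Its left arm is one vertex higher than its right arm, because the
  right arm is always the first to be extended. From column \<open>2i + 1\<close> on, when the left arm is complete, every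
  turn is spent on the right.
\<close>

definition barrier :: "nat \<Rightarrow> nat \<Rightarrow> nat \<Rightarrow> nat" where
  "barrier i j x = (if x \<le> i then j + (i - x) + 1 else if x \<le> 2 * i then j + (x - i) else j + i + 1)"

text \<open>
  The column in which a barrier vertex is protected in turn \<open>s + 1\<close>.
\<close>

definition barrier_column :: "nat \<Rightarrow> nat \<Rightarrow> nat" where
  "barrier_column i s =
     (if s \<le> 2 * i then (if even s then i - s div 2 else i + (s + 1) div 2) else s)"

lemma barrier_steps: "barrier i j x \<le> barrier i j (Suc x) + 1" "barrier i j (Suc x) \<le> barrier i j x + 1"
  by (auto simp: barrier_def)

text \<open>
  The fire advances by one per turn in the \<open>l\<^sub>1\<close> distance, and a step of a slanted arm takes two turns and
  increases the distance by two; a step of the horizontal part takes one turn and increases it by one.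
\<close>

lemma barrier_in_time: "\<exists>s < l1_dist (i, j) (x, barrier i j x). barrier_column i s = x"
proof -
  consider "x \<le> i" | "i < x" "x \<le> 2 * i" | "2 * i < x" by linarith
  then show ?thesis
  proof cases
    case 1
    then show ?thesis
      by (intro exI[of _ "2 * (i - x)"]) (auto simp: barrier_column_def l1_dist_def barrier_def)
  next
    case 2
    then obtain r where r: "x = i + Suc r" by (metis add_Suc_right less_imp_Suc_add)
    show ?thesis using 2
      by (intro exI[of _ "2 * r + 1"]) (auto simp: r barrier_column_def l1_dist_def barrier_def)
  next
    case 3
    then show ?thesis
      by (intro exI[of _ x]) (auto simp: barrier_column_def l1_dist_def barrier_def)
  qed
qed

text \<open>
  The V with its right arm raised to the height of the left one, measured from the apex; the three cases
  say in which part of the V column \<open>m\<close> lies.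
\<close>

lemma sum_tent:
  "2 * (\<Sum>x<m. int (if x \<le> i then i - x else if x \<le> 2 * i then x - i else i)) =
    (if m \<le> i then int m * (2 * int i + 1 - int m)
     else if m \<le> 2 * i + 1 then int i * (int i + 1) + (int m - int i - 1) * (int m - int i)
     else 2 * int i * (int m - int i))"
proof (induction m)
  case 0
  then show ?case by simp
next
  case (Suc m)
  consider "Suc m \<le> i" | "m = i" | "i < m" "Suc m \<le> 2 * i + 1" | "m = 2 * i + 1" | "2 * i + 1 < m"
    by linarith
  then show ?case
    by cases (use Suc in \<open>simp_all add: of_nat_diff algebra_simps\<close>)
qed

lemma sum_barrier_le:
  assumes "2 * i < n"
  shows "(\<Sum>x<n. int (barrier i j x)) \<le> int n * (int j + 1) + int i * (int n - int i)"
proof -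
  have "(\<Sum>x<n. int (barrier i j x))
      \<le> (\<Sum>x<n. int j + 1 + int (if x \<le> i then i - x else if x \<le> 2 * i then x - i else i))"
    by (intro sum_mono) (auto simp: barrier_def)
  also have "\<dots> = int n * (int j + 1)
      + (\<Sum>x<n. int (if x \<le> i then i - x else if x \<le> 2 * i then x - i else i))"
    by (simp add: sum.distrib algebra_simps)
  also have "\<dots> = int n * (int j + 1) + int i * (int n - int i)"
  proof -
    have "2 * (\<Sum>x<n. int (if x \<le> i then i - x else if x \<le> 2 * i then x - i else i))
        = 2 * int i * (int n - int i)"
    proof (cases "n = 2 * i + 1")
      case True
      then show ?thesis unfolding sum_tent by (simp add: algebra_simps)
    next
      case False
      then show ?thesis unfolding sum_tent using assms by simp
    qed
    then show ?thesis by simp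
  qed
  finally show ?thesis .
qed

lemma l1_dist_arc: "(u, w) \<in> parcs (grid n) \<Longrightarrow> l1_dist v w \<le> Suc (l1_dist v u)"
  by (cases u; cases w) (auto simp: arc_grid_iff l1_dist_def)

lemma sn_grid_lower_canonical:
  assumes ji: "j \<le> i" and i: "2 * i \<le> N" and N: "1 \<le> N"
  defines "n \<equiv> Suc N"
  shows "(int n)\<^sup>2 - int n * (int i + int j + 1) + (int i)\<^sup>2 \<le> int (sn (grid n) (i, j))"
proof -
  let ?H = "barrier i j"
  define R where "R = {(x, y). x < n \<and> y < n \<and> y < ?H x}"
  \<comment> \<open>Barrier vertices outside the grid are replaced by the apex \<open>(i, j + 1)\<close>.\<close>
  define c where "c s = (let x = barrier_column i s in
      if x < n \<and> ?H x < n then (x, ?H x) else (i, j + 1))" for s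
  have "card (pverts (grid n) - R) \<le> sn (grid n) (i, j)"
  proof (rule sn_ge_confined[where dst = "l1_dist (i, j)" and c = c])
    show "finite (pverts (grid n))" by (simp add: pverts_grid)
    show "R \<subseteq> pverts (grid n)" by (auto simp: R_def pverts_grid)
    show "(i, j) \<in> R" using ji i by (auto simp: R_def n_def barrier_def)
    show "l1_dist (i, j) (i, j) = 0" by (simp add: l1_dist_def)
    show "l1_dist (i, j) w \<le> Suc (l1_dist (i, j) u)" if "(u, w) \<in> parcs (grid n)" for u w
      using that by (rule l1_dist_arc)
    show "c t \<in> pverts (grid n) - R" for t
      using ji i N by (auto simp: c_def Let_def R_def pverts_grid n_def barrier_def)
    show "\<exists>s<l1_dist (i, j) w. c s = w"
      if u: "u \<in> R" and w: "w \<in> pverts (grid n) - R" and uw: "(u, w) \<in> parcs (grid n)" for u w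
    proof -
      obtain a b x y where uv: "u = (a, b)" "w = (x, y)" by (metis surj_pair)
      have xy: "x < n" "y < n" "?H x \<le> y" "b < ?H a"
        using u w by (auto simp: uv R_def pverts_grid)
      have "a = x \<and> (y = Suc b \<or> b = Suc y) \<or> b = y \<and> (x = Suc a \<or> a = Suc x)"
        using uw by (simp add: uv arc_grid_iff)
      then have y: "y = ?H x"
        using xy barrier_steps[of i j a] barrier_steps[of i j x] by auto
      obtain s where s: "s < l1_dist (i, j) (x, ?H x)" "barrier_column i s = x"
        using barrier_in_time by blast
      then have "c s = w" using xy by (simp add: c_def uv y)
      then show ?thesis using s by (auto simp: uv y)
    qed
  qed
  moreover have "(\<Sum>x<n. int n - int (?H x)) \<le> int (card (pverts (grid n) - R))"
  proof -
    have "pverts (grid n) - R = (SIGMA x:{..<n}. {?H x..<n})"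
      by (auto simp: pverts_grid R_def)
    then have "int (card (pverts (grid n) - R)) = (\<Sum>x<n. int (n - ?H x))" by simp
    then show ?thesis by (simp add: sum_mono)
  qed
  moreover have "(\<Sum>x<n. int n - int (?H x)) = (int n)\<^sup>2 - (\<Sum>x<n. int (?H x))"
    by (simp add: sum_subtractf power2_eq_square)
  moreover have "(\<Sum>x<n. int (?H x)) \<le> int n * (int j + 1) + int i * (int n - int i)"
    by (rule sum_barrier_le) (use i in \<open>simp add: n_def\<close>)
  ultimately show ?thesis by (simp add: algebra_simps power2_eq_square)
qed

lemma sn_grid_swap_le:
  assumes "x < n" "y < n"
  shows "sn (grid n) (x, y) \<le> sn (grid n) (y, x)"
proof -
  have "sn (grid n) (x, y) \<le> sn (grid n) (prod.swap (x, y))"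
    by (rule sn_automorphism_le)
      (use assms in \<open>auto simp: pverts_grid arc_grid_iff product_swap\<close>)
  then show ?thesis by simp
qed

lemma sn_grid_flip_le:
  assumes "x \<le> N" "y \<le> N"
  shows "sn (grid (Suc N)) (x, y) \<le> sn (grid (Suc N)) (N - x, y)"
proof -
  let ?f = "\<lambda>p. (N - fst p, snd p) :: nat \<times> nat"
  have inv: "?f (?f p) = p" if "p \<in> pverts (grid (Suc N))" for p
    using that by (auto simp: pverts_grid)
  have sub: "?f p \<in> pverts (grid (Suc N))" if "p \<in> pverts (grid (Suc N))" for p
    using that by (auto simp: pverts_grid)
  have "sn (grid (Suc N)) (x, y) \<le> sn (grid (Suc N)) (?f (x, y))"
  proof (rule sn_automorphism_le)
    show "finite (pverts (grid (Suc N)))" "(x, y) \<in> pverts (grid (Suc N))"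
      using assms by (auto simp: pverts_grid)
    show "inj_on ?f (pverts (grid (Suc N)))" by (rule inj_on_inverseI[of _ ?f]) (rule inv)
    show "?f ` pverts (grid (Suc N)) = pverts (grid (Suc N))"
    proof
      show "?f ` pverts (grid (Suc N)) \<subseteq> pverts (grid (Suc N))" using sub by blast
      show "pverts (grid (Suc N)) \<subseteq> ?f ` pverts (grid (Suc N))"
        
      proof
        fix p assume p: "p \<in> pverts (grid (Suc N))"
        show "p \<in> ?f ` pverts (grid (Suc N))"
          by (rule image_eqI[of _ _ "?f p"]) (simp_all only: inv[OF p] sub[OF p])
      qed
    qed
    show "(?f u, ?f w) \<in> parcs (grid (Suc N)) \<longleftrightarrow> (u, w) \<in> parcs (grid (Suc N))"
      if "u \<in> pverts (grid (Suc N))" "w \<in> pverts (grid (Suc N))" for u w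
      using that by (cases u; cases w) (auto simp: pverts_grid arc_grid_iff)
  qed
  then show ?thesis by simp
qed

text \<open>
  Reflections bring the outbreak into the lower left quarter, a transposition below the diagonal.
\<close>

lemma sn_grid_lower:
  fixes N x y :: nat
  assumes x: "x \<le> N" and y: "y \<le> N"
  defines "n \<equiv> Suc N" and "X \<equiv> min x (N - x)" and "Y \<equiv> min y (N - y)"
  shows "(int n)\<^sup>2 - int n * (int X + int Y + 1) + (max (int X) (int Y))\<^sup>2 \<le> int (sn (grid n) (x, y))"
proof (cases "N = 0")
  case True
  then show ?thesis by (simp add: X_def Y_def n_def)
next
  case False
  have flip: "sn (grid n) (N - a, b) \<le> sn (grid n) (a, b)" if "a \<le> N" "b \<le> N" for a b
    using sn_grid_flip_le[of "N - a" N b] that by (simp add: n_def)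
  have swap: "sn (grid n) (a, b) \<le> sn (grid n) (b, a)" if "a \<le> N" "b \<le> N" for a b
    using sn_grid_swap_le[of a n b] that by (simp add: n_def)
  have XN: "X \<le> N" "2 * X \<le> N" and YN: "Y \<le> N" "2 * Y \<le> N" by (auto simp: X_def Y_def)
  have "sn (grid n) (X, Y) \<le> sn (grid n) (x, Y)"
    using flip[OF x YN(1)] by (auto simp: X_def min_def)
  also have "\<dots> \<le> sn (grid n) (Y, x)" by (rule swap[OF x YN(1)])
  also have "\<dots> \<le> sn (grid n) (y, x)" using flip[OF y x] by (auto simp: Y_def min_def)
  also have "\<dots> \<le> sn (grid n) (x, y)" by (rule swap[OF y x])
  finally have XY: "int (sn (grid n) (X, Y)) \<le> int (sn (grid n) (x, y))" by simp
  show ?thesis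
  proof (cases "Y \<le> X")
    case True
    have "(int n)\<^sup>2 - int n * (int X + int Y + 1) + (int X)\<^sup>2 \<le> int (sn (grid n) (X, Y))"
      unfolding n_def using sn_grid_lower_canonical[OF True XN(2)] False by simp
    moreover have "max (int X) (int Y) = int X" using True by simp
    ultimately show ?thesis using XY by simp
  next
    case F: False
    have "sn (grid n) (Y, X) \<le> sn (grid n) (X, Y)" by (rule swap[OF YN(1) XN(1)])
    moreover have "(int n)\<^sup>2 - int n * (int Y + int X + 1) + (int Y)\<^sup>2 \<le> int (sn (grid n) (Y, X))"
      unfolding n_def using sn_grid_lower_canonical[of X Y N] F YN(2) False by simp
    moreover have "max (int X) (int Y) = int Y" using F by simp
    ultimately show ?thesis using XY by (simp add: add.commute)
  qed
qed

section \<open>Averages over all outbreaks\<close>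

definition side_dist :: "nat \<Rightarrow> nat \<Rightarrow> nat" where
  "side_dist N x = min x (N - x)"

text \<open>
  Sums of functions of \<open>side_dist\<close> are computed by layers: \<open>m\<close> is the number of \<open>k \<ge> 1\<close> with \<open>k \<le> m\<close>,
  \<open>m\<^sup>2\<close> is the sum of the odd numbers \<open>2k - 1\<close> over these \<open>k\<close>, and \<open>k \<le> min a b\<close> is a conjunction,
  so that the sum over the square factorises for each \<open>k\<close>.
\<close>

lemma sum_of_bool_side_dist:
  "(\<Sum>x\<le>N. of_bool (k \<le> side_dist N x)) = int (Suc N - 2 * k)"
proof -
  have "{..N} \<inter> {x. k \<le> side_dist N x} = {k..N - k} \<inter> {..N}"
    by (auto simp: side_dist_def)
  also have "\<dots> = {k..N - k}" by auto
  also have "card \<dots> = Suc N - 2 * k" by auto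
  finally show ?thesis by simp
qed

lemma sum_odd_of_bool: "m \<le> N \<Longrightarrow> (\<Sum>k=1..N. (2 * int k - 1) * of_bool (k \<le> m)) = (int m)\<^sup>2"
proof (induction N arbitrary: m)
  case (Suc N)
  show ?case
  proof (cases "m = Suc N")
    case True
    have "(\<Sum>k=1..N. (2 * int k - 1) * of_bool (k \<le> m)) = (\<Sum>k=1..N. (2 * int k - 1) * of_bool (k \<le> N))"
      by (intro sum.cong) (auto simp: True)
    then show ?thesis using Suc.IH[of N] True by (simp add: power2_eq_square algebra_simps)
  next
    case False
    then show ?thesis using Suc by simp
  qed
qed simp

lemma sum_one_of_bool: "m \<le> N \<Longrightarrow> (\<Sum>k=1..N. of_bool (k \<le> m)) = int m"
proof (induction N arbitrary: m)
  case (Suc N)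
  show ?case
  proof (cases "m = Suc N")
    case True
    have "(\<Sum>k=1..N. of_bool (k \<le> m)) = (\<Sum>k=1..N. of_bool (k \<le> N) :: int)"
      by (intro sum.cong) (auto simp: True)
    then show ?thesis using Suc.IH[of N] True by simp
  next
    case False
    then show ?thesis using Suc by simp
  qed
qed simp

lemma side_dist_le: "side_dist N x \<le> N" if "x \<le> N"
  using that by (auto simp: side_dist_def)

lemma sum_truncate:
  assumes "\<And>k. g k 0 = (0::int)"
  shows "(\<Sum>k=1..N. g k (int (Suc N - 2 * k))) = (\<Sum>k=1..Suc N div 2. g k (int (Suc N) - 2 * int k))"
proof -
  have "(\<Sum>k=1..N. g k (int (Suc N - 2 * k))) = (\<Sum>k=1..Suc N div 2. g k (int (Suc N - 2 * k)))"
    by (rule sum.mono_neutral_right) (auto simp: assms)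
  also have "\<dots> = (\<Sum>k=1..Suc N div 2. g k (int (Suc N) - 2 * int k))"
    by (rule sum.cong) (auto simp: of_nat_diff)
  finally show ?thesis .
qed

lemma sum_side_dist:
  "(\<Sum>x\<le>N. int (side_dist N x)) = (\<Sum>k=1..Suc N div 2. int (Suc N) - 2 * int k)"
proof -
  have "(\<Sum>x\<le>N. int (side_dist N x)) = (\<Sum>x\<le>N. \<Sum>k=1..N. of_bool (k \<le> side_dist N x))"
    by (intro sum.cong refl sum_one_of_bool[symmetric]) (simp add: side_dist_le)
  also have "\<dots> = (\<Sum>k=1..N. \<Sum>x\<le>N. of_bool (k \<le> side_dist N x))" by (rule sum.swap)
  also have "\<dots> = (\<Sum>k=1..N. int (Suc N - 2 * k))" by (simp only: sum_of_bool_side_dist)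
  also have "\<dots> = (\<Sum>k=1..Suc N div 2. int (Suc N) - 2 * int k)"
    by (rule sum_truncate) simp
  finally show ?thesis .
qed

lemma sum_side_dist_square:
  "(\<Sum>x\<le>N. (int (side_dist N x))\<^sup>2)
    = (\<Sum>k=1..Suc N div 2. (2 * int k - 1) * (int (Suc N) - 2 * int k))"
proof -
  have "(\<Sum>x\<le>N. (int (side_dist N x))\<^sup>2)
      = (\<Sum>x\<le>N. \<Sum>k=1..N. (2 * int k - 1) * of_bool (k \<le> side_dist N x))"
    by (intro sum.cong refl sum_odd_of_bool[symmetric]) (simp add: side_dist_le)
  also have "\<dots> = (\<Sum>k=1..N. \<Sum>x\<le>N. (2 * int k - 1) * of_bool (k \<le> side_dist N x))" by (rule sum.swap)
  also have "\<dots> = (\<Sum>k=1..N. (2 * int k - 1) * int (Suc N - 2 * k))"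
    by (simp only: sum_of_bool_side_dist flip: sum_distrib_left)
  also have "\<dots> = (\<Sum>k=1..Suc N div 2. (2 * int k - 1) * (int (Suc N) - 2 * int k))"
    by (rule sum_truncate) simp
  finally show ?thesis .
qed

lemma sum_min_side_dist_square:
  "(\<Sum>x\<le>N. \<Sum>y\<le>N. (int (min (side_dist N x) (side_dist N y)))\<^sup>2)
    = (\<Sum>k=1..Suc N div 2. (2 * int k - 1) * (int (Suc N) - 2 * int k)\<^sup>2)"
proof -
  let ?o = "\<lambda>k x. of_bool (k \<le> side_dist N x) :: int"
  have "(int (min (side_dist N x) (side_dist N y)))\<^sup>2 = (\<Sum>k=1..N. (2 * int k - 1) * (?o k x * ?o k y))"
    if "x \<le> N" "y \<le> N" for x y
    using sum_odd_of_bool[of "min (side_dist N x) (side_dist N y)" N] side_dist_le[OF that(1)]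
    by (simp add: of_bool_conj min_le_iff_disj)
  then have "(\<Sum>x\<le>N. \<Sum>y\<le>N. (int (min (side_dist N x) (side_dist N y)))\<^sup>2)
      = (\<Sum>x\<le>N. \<Sum>y\<le>N. \<Sum>k=1..N. (2 * int k - 1) * (?o k x * ?o k y))"
    by (intro sum.cong) auto
  also have "\<dots> = (\<Sum>x\<le>N. \<Sum>k=1..N. \<Sum>y\<le>N. (2 * int k - 1) * (?o k x * ?o k y))"
    by (intro sum.cong refl sum.swap)
  also have "\<dots> = (\<Sum>k=1..N. \<Sum>x\<le>N. \<Sum>y\<le>N. (2 * int k - 1) * (?o k x * ?o k y))"
    by (rule sum.swap)
  also have "\<dots> = (\<Sum>k=1..N. (2 * int k - 1) * ((\<Sum>x\<le>N. ?o k x) * (\<Sum>y\<le>N. ?o k y)))"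
    by (simp only: sum_product) (simp only: sum_distrib_left)
  also have "\<dots> = (\<Sum>k=1..N. (2 * int k - 1) * (int (Suc N - 2 * k))\<^sup>2)"
    by (simp only: sum_of_bool_side_dist power2_eq_square)
  also have "\<dots> = (\<Sum>k=1..Suc N div 2. (2 * int k - 1) * (int (Suc N) - 2 * int k)\<^sup>2)"
    by (rule sum_truncate) simp
  finally show ?thesis .
qed

text \<open>
  The numbers of points in the layers vanish beyond the middle, so the sums end at \<open>h = n div 2\<close>, where
  they are polynomials in \<open>n\<close> and \<open>h\<close>.
\<close>

lemma closed_sum_linear: "(\<Sum>k=1..h. a - 2 * int k) = a * int h - int h * (int h + 1)"
  by (induction h) (auto simp: algebra_simps)

lemma closed_sum_quadratic:
  "3 * (\<Sum>k=1..h. (2 * int k - 1) * (a - 2 * int k))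
    = 3 * a * (int h)\<^sup>2 - int h * (int h + 1) * (4 * int h - 1)"
  by (induction h) (auto simp: algebra_simps power2_eq_square)

lemma closed_sum_cubic:
  "3 * (\<Sum>k=1..h. (2 * int k - 1) * (a - 2 * int k)\<^sup>2)
    = 3 * a\<^sup>2 * (int h)\<^sup>2 - 2 * a * int h * (int h + 1) * (4 * int h - 1)
      + 6 * (int h)\<^sup>2 * (int h + 1)\<^sup>2 - 2 * int h * (int h + 1) * (2 * int h + 1)"
  by (induction h) (auto simp: algebra_simps power2_eq_square)

lemma half_cases:
  obtains h :: int where "h \<ge> 0" "int (n div 2) = h" "int n = 2 * h \<or> int n = 2 * h + 1"
  by (rule that[of "int (n div 2)"]) presburger+

text \<open>
  To leading order, the sums over \<open>side_dist\<close> and its square are \<open>n\<^sup>2/4\<close> and \<open>n\<^sup>3/12\<close>, and the sum over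
  the squared distance to the boundary is \<open>n\<^sup>4/24\<close>.
\<close>

lemma side_dist_sum_bounds:
  fixes N :: nat
  defines "n \<equiv> int (Suc N)"
  defines "m \<equiv> \<Sum>x\<le>N. \<Sum>y\<le>N. (int (min (side_dist N x) (side_dist N y)))\<^sup>2"
  shows "4 * (\<Sum>x\<le>N. int (side_dist N x)) \<le> n ^ 2"
    and "n ^ 3 - 3 * n ^ 2 \<le> 12 * (\<Sum>x\<le>N. (int (side_dist N x))\<^sup>2)"
    and "n ^ 4 - 4 * n ^ 3 \<le> 24 * m" and "24 * m \<le> n ^ 4"
proof -
  obtain h where h: "h \<ge> 0" "int (Suc N div 2) = h" "n = 2 * h \<or> n = 2 * h + 1"
    using half_cases[of "Suc N"] unfolding n_def by metis
  have h': "h * h \<ge> 0" "h * (h * h) \<ge> 0" "h * (h * (h * h)) \<ge> 0" "h * h \<ge> h"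
    using h(1) by (auto intro: mult_nonneg_nonneg simp: mult_le_cancel_left1)
  have h3: "h * (h * h) \<ge> h * h" using h(1) h'(4) by (intro mult_left_mono)
  show "4 * (\<Sum>x\<le>N. int (side_dist N x)) \<le> n ^ 2"
    unfolding sum_side_dist closed_sum_linear h(2) n_def[symmetric] using h(1,3) h'
    by (elim disjE) (simp_all add: algebra_simps eval_nat_numeral)
  show "n ^ 3 - 3 * n ^ 2 \<le> 12 * (\<Sum>x\<le>N. (int (side_dist N x))\<^sup>2)"
    using closed_sum_quadratic[of n "Suc N div 2"]
    unfolding sum_side_dist_square h(2) n_def[symmetric] using h(1,3) h'
    by (elim disjE) (simp_all add: algebra_simps eval_nat_numeral)
  show "n ^ 4 - 4 * n ^ 3 \<le> 24 * m"
    using closed_sum_cubic[of n "Suc N div 2"]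
    unfolding m_def sum_min_side_dist_square h(2) n_def[symmetric] using h(1,3) h' h3
    by (elim disjE) (simp_all add: algebra_simps eval_nat_numeral)
  show "24 * m \<le> n ^ 4"
    using closed_sum_cubic[of n "Suc N div 2"]
    unfolding m_def sum_min_side_dist_square h(2) n_def[symmetric] using h(1,3) h' h3
    by (elim disjE) (simp_all add: algebra_simps eval_nat_numeral)
qed

lemma sum_eccentricity:
  "3 * (\<Sum>x\<le>N. \<Sum>y\<le>N. (int N - int x - int y)\<^sup>2 + (int x - int y)\<^sup>2) = (int (Suc N))\<^sup>2 * ((int (Suc N))\<^sup>2 - 1)"
proof -
  have s1: "2 * (\<Sum>x\<le>N. int x) = int N * (int N + 1)"
    by (induction N) (auto simp: algebra_simps)
  have s2: "6 * (\<Sum>x\<le>N. (int x)\<^sup>2) = int N * (int N + 1) * (2 * int N + 1)"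
    by (induction N) (auto simp: algebra_simps power2_eq_square)
  define T Z where "T = (\<Sum>x\<le>N. int x)" and "Z = (\<Sum>x\<le>N. (int x)\<^sup>2)"
  have inner: "(\<Sum>y\<le>N. (int N - int x - int y)\<^sup>2 + (int x - int y)\<^sup>2)
      = (int N + 1) * (int N)\<^sup>2 - 2 * int N * T + 2 * Z
        + (2 * (int N + 1) * (int x)\<^sup>2 - 2 * int N * (int N + 1) * int x)" for x
  proof -
    have "(\<Sum>y\<le>N. (int N - int x - int y)\<^sup>2 + (int x - int y)\<^sup>2)
        = (\<Sum>y\<le>N. ((int N)\<^sup>2 - 2 * int N * int x + 2 * (int x)\<^sup>2) - 2 * int N * int y + 2 * (int y)\<^sup>2)"
      by (intro sum.cong refl) (simp add: power2_eq_square algebra_simps)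
    also have "\<dots> = (int N + 1) * ((int N)\<^sup>2 - 2 * int N * int x + 2 * (int x)\<^sup>2) - 2 * int N * T + 2 * Z"
      by (simp add: sum.distrib sum_subtractf T_def Z_def flip: sum_distrib_left)
    finally show ?thesis by (simp add: algebra_simps)
  qed
  have "(\<Sum>x\<le>N. \<Sum>y\<le>N. (int N - int x - int y)\<^sup>2 + (int x - int y)\<^sup>2)
      = (int N + 1) * ((int N + 1) * (int N)\<^sup>2 - 2 * int N * T + 2 * Z)
        + (2 * (int N + 1) * Z - 2 * int N * (int N + 1) * T)"
    unfolding inner by (simp add: sum.distrib sum_subtractf T_def Z_def flip: sum_distrib_left)
  also have "\<dots> = (int N + 1)\<^sup>2 * (int N)\<^sup>2 - 4 * int N * (int N + 1) * T + 4 * (int N + 1) * Z"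
    by (simp add: power2_eq_square algebra_simps)
  finally have "3 * (\<Sum>x\<le>N. \<Sum>y\<le>N. (int N - int x - int y)\<^sup>2 + (int x - int y)\<^sup>2)
      = 3 * (int N + 1)\<^sup>2 * (int N)\<^sup>2 - 6 * int N * (int N + 1) * (2 * T)
        + 2 * (int N + 1) * (6 * Z)"
    by (simp add: algebra_simps)
  then show ?thesis unfolding T_def Z_def s1 s2 by (simp add: power2_eq_square algebra_simps)
qed

text \<open>
  The leading coefficient is \<open>5/8 = 1 - 1/2 + 1/6 - 1/24\<close>. The sum over the larger of the two distances squared
  comes from \<open>max\<^sup>2 + min\<^sup>2\<close> being the sum of both squares.
\<close>

lemma sum_sn_grid_lower:
  fixes N :: nat
  defines "n \<equiv> int (Suc N)"
  shows "5 * n ^ 4 - 12 * n ^ 3 \<le> 8 * (\<Sum>x\<le>N. \<Sum>y\<le>N. int (sn (grid (Suc N)) (x, y)))"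
proof -
  let ?s = "\<lambda>x. int (side_dist N x)"
  define L Q m where "L = (\<Sum>x\<le>N. ?s x)" and "Q = (\<Sum>x\<le>N. (?s x)\<^sup>2)"
    and "m = (\<Sum>x\<le>N. \<Sum>y\<le>N. (int (min (side_dist N x) (side_dist N y)))\<^sup>2)"
  have max_sq: "(max a b)\<^sup>2 = a\<^sup>2 + b\<^sup>2 - (min a b)\<^sup>2" for a b :: int by (auto simp: max_def min_def)
  have "(\<Sum>x\<le>N. \<Sum>y\<le>N. n\<^sup>2 - n * (?s x + ?s y + 1)
      + ((?s x)\<^sup>2 + (?s y)\<^sup>2 - (int (min (side_dist N x) (side_dist N y)))\<^sup>2))
      \<le> (\<Sum>x\<le>N. \<Sum>y\<le>N. int (sn (grid (Suc N)) (x, y)))"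
  proof (intro sum_mono)
    fix x y assume "x \<in> {..N}" "y \<in> {..N}"
    then show "n\<^sup>2 - n * (?s x + ?s y + 1)
      + ((?s x)\<^sup>2 + (?s y)\<^sup>2 - (int (min (side_dist N x) (side_dist N y)))\<^sup>2)
      \<le> int (sn (grid (Suc N)) (x, y))"
      using sn_grid_lower[of x N y] max_sq[of "?s x" "?s y"]
      by (simp add: n_def side_dist_def of_nat_min)
  qed
  moreover have "(\<Sum>x\<le>N. \<Sum>y\<le>N. n\<^sup>2 - n * (?s x + ?s y + 1)
      + ((?s x)\<^sup>2 + (?s y)\<^sup>2 - (int (min (side_dist N x) (side_dist N y)))\<^sup>2))
      = n ^ 4 - n ^ 3 - 2 * n\<^sup>2 * L + 2 * n * Q - m"
    unfolding L_def Q_def m_def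
    by (simp add: sum.distrib sum_subtractf sum_distrib_left[symmetric] algebra_simps
        eval_nat_numeral n_def)
  moreover have "n\<^sup>2 * (4 * L) \<le> n\<^sup>2 * n ^ 2"
    using side_dist_sum_bounds(1)[of N] by (intro mult_left_mono) (simp_all add: n_def L_def)
  moreover have "n * (n ^ 3 - 3 * n ^ 2) \<le> n * (12 * Q)"
    using side_dist_sum_bounds(2)[of N] by (intro mult_left_mono) (simp_all add: n_def Q_def)
  moreover have "24 * m \<le> n ^ 4"
    using side_dist_sum_bounds(4)[of N] by (simp add: n_def m_def)
  ultimately show ?thesis by (simp add: algebra_simps eval_nat_numeral)
qed

text \<open>
  The leading coefficient is \<open>61/96 = (2 - 3/24 + 2/3) / 4\<close>.
\<close>

lemma sum_sn_grid_upper: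
  fixes N :: nat
  defines "n \<equiv> int (Suc N)"
  shows "96 * (\<Sum>x\<le>N. \<Sum>y\<le>N. int (sn (grid (Suc N)) (x, y))) \<le> 61 * n ^ 4 + 60 * n ^ 3"
proof -
  define m e where "m = (\<Sum>x\<le>N. \<Sum>y\<le>N. (int (min (side_dist N x) (side_dist N y)))\<^sup>2)"
    and "e = (\<Sum>x\<le>N. \<Sum>y\<le>N. (int N - int x - int y)\<^sup>2 + (int x - int y)\<^sup>2)"
  have "(\<Sum>x\<le>N. \<Sum>y\<le>N. 4 * int (sn (grid (Suc N)) (x, y)))
      \<le> (\<Sum>x\<le>N. \<Sum>y\<le>N. 2 * n\<^sup>2 + 2 * n - 3 * (int (min (side_dist N x) (side_dist N y)))\<^sup>2
          + 2 * ((int N - int x - int y)\<^sup>2 + (int x - int y)\<^sup>2))"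
  proof (intro sum_mono)
    fix x y assume "x \<in> {..N}" "y \<in> {..N}"
    then show "4 * int (sn (grid (Suc N)) (x, y))
      \<le> 2 * n\<^sup>2 + 2 * n - 3 * (int (min (side_dist N x) (side_dist N y)))\<^sup>2
          + 2 * ((int N - int x - int y)\<^sup>2 + (int x - int y)\<^sup>2)"
      unfolding n_def side_dist_def by (intro sn_grid_upper) auto
  qed
  also have "\<dots> = 2 * n ^ 4 + 2 * n ^ 3 - 3 * m + 2 * e"
    unfolding m_def e_def
    by (simp only: sum.distrib sum_subtractf sum_distrib_left[symmetric])
      (simp add: n_def algebra_simps eval_nat_numeral)
  finally have "4 * (\<Sum>x\<le>N. \<Sum>y\<le>N. int (sn (grid (Suc N)) (x, y))) \<le> 2 * n ^ 4 + 2 * n ^ 3 - 3 * m + 2 * e"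
    by (simp only: sum_distrib_left)
  moreover have "n ^ 4 - 4 * n ^ 3 \<le> 24 * m"
    using side_dist_sum_bounds(3)[of N] by (simp add: n_def m_def)
  moreover have "3 * e = n ^ 4 - n\<^sup>2"
    unfolding e_def sum_eccentricity n_def by (simp add: algebra_simps eval_nat_numeral)
  moreover have "n\<^sup>2 \<ge> 0" by simp
  ultimately show ?thesis by linarith
qed

lemma surviving_rate_grid:
  "surviving_rate (grid (Suc N))
    = real_of_int (\<Sum>x\<le>N. \<Sum>y\<le>N. int (sn (grid (Suc N)) (x, y))) / real (Suc N) ^ 4"
proof -
  have "(\<Sum>v\<in>pverts (grid (Suc N)). real (sn (grid (Suc N)) v))
      = (\<Sum>x\<le>N. \<Sum>y\<le>N. real (sn (grid (Suc N)) (x, y)))"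
    by (simp add: pverts_grid sum.cartesian_product lessThan_Suc_atMost)
  moreover have "(real (card (pverts (grid (Suc N)))))\<^sup>2 = real (Suc N) ^ 4"
    
  proof -
    have "(a * a)\<^sup>2 = a ^ 4" for a :: real by (simp add: eval_nat_numeral mult.assoc)
    then show ?thesis by (simp only: pverts_grid card_cartesian_product card_lessThan of_nat_mult)
  qed
  ultimately show ?thesis by (simp only: surviving_rate_def) simp
qed

lemma surviving_rate_grid_bounds:
  assumes "n \<ge> 1"
  shows "5 / 8 - 2 / real n \<le> surviving_rate (grid n)"
    and "surviving_rate (grid n) \<le> 61 / 96 + 1 / real n"
proof -
  obtain N where N: "n = Suc N" using assms by (cases n) auto
  define S where "S = (\<Sum>x\<le>N. \<Sum>y\<le>N. int (sn (grid (Suc N)) (x, y)))"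
  have pos: "real n > 0" using assms by simp
  have S: "surviving_rate (grid n) = real_of_int S / real n ^ 4"
    unfolding N S_def by (rule surviving_rate_grid)
  have cancel: "c / real n * real n ^ 4 = c * real n ^ 3" for c
    using pos by (simp add: eval_nat_numeral)
  have cube: "real n ^ 3 \<ge> 0" by simp
  have "real_of_int (5 * int n ^ 4 - 12 * int n ^ 3) \<le> real_of_int (8 * S)"
    unfolding of_int_le_iff N S_def by (rule sum_sn_grid_lower)
  then have "5 * real n ^ 4 - 12 * real n ^ 3 \<le> 8 * real_of_int S" by simp
  then have "(5 / 8 - 2 / real n) * real n ^ 4 \<le> real_of_int S"
    unfolding left_diff_distrib cancel using cube by linarith
  then show "5 / 8 - 2 / real n \<le> surviving_rate (grid n)"
    unfolding S using pos by (simp add: pos_le_divide_eq)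
  have "real_of_int (96 * S) \<le> real_of_int (61 * int n ^ 4 + 60 * int n ^ 3)"
    unfolding of_int_le_iff N S_def by (rule sum_sn_grid_upper)
  then have "96 * real_of_int S \<le> 61 * real n ^ 4 + 60 * real n ^ 3" by simp
  then have "real_of_int S \<le> (61 / 96 + 1 / real n) * real n ^ 4"
    unfolding distrib_right cancel using cube by linarith
  then show "surviving_rate (grid n) \<le> 61 / 96 + 1 / real n"
    unfolding S using pos by (simp add: pos_divide_le_eq)
qed

theorem theorem1:
  shows "\<exists>\<epsilon> \<delta> :: nat \<Rightarrow> real. \<epsilon> \<in> o(\<lambda>_. 1) \<and> \<delta> \<in> o(\<lambda>_. 1) \<and>
    (\<forall>n\<ge>1. 0.625 + \<epsilon> n = 5 / 8 + \<epsilon> n \<and>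
            5 / 8 + \<epsilon> n \<le> surviving_rate (path_graph n \<box> path_graph n) \<and>
            surviving_rate (path_graph n \<box> path_graph n) \<le> 67243 / 105300 + \<delta> n) \<and>
    (\<forall>\<^sub>F n in sequentially. 67243 / 105300 + \<delta> n < 0.6386)"
proof (intro exI conjI allI impI)
  let ?\<epsilon> = "\<lambda>n::nat. - 2 / real n" and ?\<delta> = "\<lambda>n::nat. 1 / real n"
  have lim: "(\<lambda>n. c / real n) \<longlonglongrightarrow> 0" for c :: real by (rule lim_const_over_n)
  show "?\<epsilon> \<in> o(\<lambda>_. 1)" "?\<delta> \<in> o(\<lambda>_. 1)"
    by (rule smalloI_tendsto; use lim[of "- 2"] lim[of 1] in simp)+
  show "\<forall>\<^sub>F n in sequentially. 67243 / 105300 + ?\<delta> n < 0.6386"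
  proof -
    have "\<forall>\<^sub>F n in sequentially. ?\<delta> n < 0.6386 - 67243 / 105300"
      by (rule order_tendstoD(2)[OF lim]) simp
    then show ?thesis by eventually_elim simp
  qed
  fix n :: nat assume n: "1 \<le> n"
  show "0.625 + ?\<epsilon> n = 5 / 8 + ?\<epsilon> n" by simp
  show "5 / 8 + ?\<epsilon> n \<le> surviving_rate (grid n)"
    using surviving_rate_grid_bounds(1)[OF n] by simp
  show "surviving_rate (grid n) \<le> 67243 / 105300 + ?\<delta> n"
    using surviving_rate_grid_bounds(2)[OF n] by simp
qed

end
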